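(* Let $g_{2,1}(t)=\left(\frac{\pi}{2}\right)^{1/2}\frac{1}{\cosh\pi t}$ for $t\in\mathbb{R}$, and for $s\in\mathbb{R}$ not of the form $n+\frac12$, $n\in\mathbb{Z}$, define the "singular" dual function at critical density $a=b=1$ by $$g^d_{2,1}(s)=\int_0^1\frac{d\nu}{(Zg_{2,1})^{\ast}(s,\nu)} .$$ Then for all $t\in(-\frac12,\frac12)$ and $n\in\mathbb{Z}$, $$g^d_{2,1}(t+n)=\frac{2^{\frac12}(-1)^n\,\vartheta_4(\pi t;e^{-\pi})^2\,e^{2\pi t^2+2\pi nt}}{\pi^{\frac12}\,\bigl(\vartheta_1'(0;e^{-\pi})\bigr)^2\cosh\pi(t+n)} .$$
   Context: The Zak transform of a function $g$ is $(Zg)(t,\nu)=\sum_{l=-\infty}^{\infty}g(t-l)e^{2\pi i l\nu}$, $t,\nu\in\mathbb{R}$; the superscript $\ast$ denotes complex conjugation. For $s\in\mathbb{R}$ not of the form $n+\frac12$ with $n\in\mathbb{Z}$, $(Zg_{2,1})(s,\nu)$ is a zero-free function of $\nu\in\mathbb{R}$. The theta functions are, for $q\in(0,1)$ and $z\in\mathbb{C}$, $\vartheta_1(z;q)=\frac1i\sum_{n=-\infty}^{\infty}(-1)^nq^{(n+\frac12)^2}e^{(2n+1)iz}$ and $\vartheta_4(z;q)=\sum_{n=-\infty}^{\infty}(-1)^nq^{n^2}e^{2niz}$. The prime in $\vartheta_1'$ denotes the derivative with respect to $z$. *)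

theory Defs
  imports "HOL-Analysis.Analysis"
begin

text \<open>
  Bi-infinite series are unconditional sums over the integers. For \<open>0 < q < 1\<close>, and
  for the function \<open>g21\<close> below, they converge absolutely, so this agrees with the sum from minus to plus infinity.
\<close>

definition zak :: "(real \<Rightarrow> complex) \<Rightarrow> real \<Rightarrow> real \<Rightarrow> complex" where
  "zak g t \<nu> = (\<Sum>\<^sub>\<infinity>l::int. g (t - of_int l) * exp (2 * of_real pi * \<i> * of_int l * of_real \<nu>))"

definition theta1 :: "complex \<Rightarrow> real \<Rightarrow> complex" where
  "theta1 z q = (1 / \<i>) * (\<Sum>\<^sub>\<infinity>n::int. (-1) powi n * of_real (q powr ((of_int n + 1/2)\<^sup>2))
     * exp ((2 * of_int n + 1) * \<i> * z))"

definition theta4 :: "complex \<Rightarrow> real \<Rightarrow> complex" where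
  "theta4 z q = (\<Sum>\<^sub>\<infinity>n::int. (-1) powi n * of_real (q powr ((of_int n)\<^sup>2))
     * exp (2 * of_int n * \<i> * z))"

definition theta1' :: "complex \<Rightarrow> real \<Rightarrow> complex" where
  "theta1' z q = deriv (\<lambda>w. theta1 w q) z"

definition g21 :: "real \<Rightarrow> complex" where
  "g21 t = of_real (sqrt (pi / 2) * (1 / cosh (pi * t)))"

text \<open>
  Only meaningful when \<open>s\<close> is not of the form \<open>n + 1/2\<close> with \<open>n\<close> an integer:
  for such \<open>s\<close>, \<open>zak g21 s\<close> has no zeros and the integrand is continuous.
\<close>

definition g21_dual :: "real \<Rightarrow> complex" where
  "g21_dual s = integral {0..1} (\<lambda>\<nu>. 1 / cnj (zak g21 s \<nu>))"

end

theory Submission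
  imports Defs "HOL-Complex_Analysis.Complex_Analysis"
begin

text \<open>
  Put $a_l = 1/\cosh \pi(l-t)$ and $c_m = (-1)^m e^{2\pi m t}/\cosh \pi(m+t)$. Partial fractions
  reduce the convolution $\sum_l a_l c_{k-l}$ to Lambert-type series in
  $1/(1+e^{2\pi(l-t)})$; a double geometric series with an antisymmetric exponent shows that
  they cancel for $k \neq 0$. So the Fourier series with coefficients $a$ and $c$ have constant
  product $S(t) = \sum_l (-1)^l e^{-2\pi l t}/\cosh^2 \pi(l-t)$, and up to a constant factor
  the dual function is the sequence $c_n/S(t)$. The same cancellation makes
  $e^{2\pi t^2} \vartheta_4(\pi t)^2 S(t)$ invariant under $t \mapsto t+1$, besides the evident
  invariance under $t \mapsto t+i$. The double pole of $S$ at $i/2$ is cancelled by the double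
  zero of $\vartheta_4^2$, so this product is constant by the maximum modulus principle, and its
  value at $i/2$ is $\vartheta_1'(0)^2$.
\<close>

section \<open>Summation over the integers\<close>

text \<open>The product in question is elliptic without poles, which suggests Liouville's theorem.
  But the series S converges absolutely only for |Re t| < 1, so no entire function is at hand, and a
  shift by 1 is available only when both points lie in that strip. An open rectangle reaching beyond
  the closed unit cell on every side is enough: all values on it are taken on the cell, so the
  modulus has a maximum at an interior point. The interval |t| < 1/2 is imposed by c: the growth of
  exp (2 pi m t) against cosh pi(m+t) leaves the decay exp (- pi (1 - 2|t|) |m|), and the two
  Fourier series are to be multiplied absolutely. Dividing by S(t) requires S(t) nonzero. This
  follows at every real t in the strip once the constant is nonzero, and that is checked at t = 0
  alone, where the series for theta and for S are both dominated by their zeroth term. Since the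
  product of the two Fourier series is then a nonzero number, the Zak transform needs no separate
  argument to be zero-free.\<close>

lemma abs_summable_on_imp_has_sum:
  fixes f :: "'a \<Rightarrow> complex"
  assumes "g summable_on A" "\<And>x. x \<in> A \<Longrightarrow> norm (f x) \<le> g x"
  shows "(f has_sum infsum f A) A"
  using Infinite_Sum.abs_summable_on_comparison_test'[OF assms]
  by (metis Infinite_Sum.abs_summable_summable has_sum_infsum)

lemma nonneg_summable_on_Times:
  fixes f :: "'a \<Rightarrow> real" and g :: "'b \<Rightarrow> real"
  assumes "f summable_on A" "g summable_on B" "\<And>x. f x \<ge> 0" "\<And>y. g y \<ge> 0"
  shows "(\<lambda>(x, y). f x * g y) summable_on A \<times> B"
proof -
  have "(\<lambda>p. norm ((\<lambda>(x, y). f x * g y) p)) summable_on (A \<times> B)"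
    unfolding Infinite_Sum.abs_summable_on_Sigma_iff
    using assms by (simp add: abs_mult infsum_cmult_right' summable_on_cmult_right summable_on_cmult_left)
  then show ?thesis by (rule Infinite_Sum.abs_summable_summable)
qed

lemma has_sum_int:
  fixes f :: "int \<Rightarrow> complex"
  assumes "((\<lambda>n::nat. f (int n + 1)) has_sum a) UNIV" "((\<lambda>n::nat. f (- int n)) has_sum b) UNIV"
  shows "(f has_sum (a + b)) UNIV"
proof -
  have 1: "bij_betw (\<lambda>n::nat. int n + 1) UNIV {0<..}"
    by (rule bij_betwI[of _ _ _ "\<lambda>k. nat (k - 1)"]) auto
  have 2: "bij_betw (\<lambda>n::nat. - int n) UNIV {..0}"
    by (rule bij_betwI[of _ _ _ "\<lambda>k. nat (- k)"]) auto
  have "(f has_sum a) {0<..}" "(f has_sum b) {..0}"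
    using assms has_sum_reindex_bij_betw[OF 1, of f] has_sum_reindex_bij_betw[OF 2, of f] by auto
  moreover have "{0<..} \<union> {..0} = (UNIV :: int set)" by auto
  ultimately show ?thesis using has_sum_Un_disjoint[where f = f and a = a and b = b and A = "{0<..}" and B = "{..0}"] by fastforce
qed

lemma has_sum_nat_Suc:
  fixes f :: "nat \<Rightarrow> complex"
  assumes "((\<lambda>n. f (Suc n)) has_sum s) UNIV"
  shows "(f has_sum (f 0 + s)) UNIV"
proof -
  have "(f has_sum s) (range Suc)"
    using assms by (simp add: has_sum_reindex o_def)
  then have "(f has_sum (f 0 + s)) (insert 0 (range Suc))"
    by (intro has_sum_insert) auto
  then show ?thesis by (metis UNIV_nat_eq)
qed

lemma has_sum_diff:
  fixes f g :: "'a \<Rightarrow> complex"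
  assumes "(f has_sum a) A" "(g has_sum b) A"
  shows "((\<lambda>x. f x - g x) has_sum (a - b)) A"
  using has_sum_add[OF assms(1), of "\<lambda>x. - g x" "- b"] assms(2) by (simp add: has_sum_uminus)

lemma exp_nat_summable_on:
  assumes "c > 0"
  shows "(\<lambda>n::nat. exp (- c * real n)) summable_on UNIV"
proof -
  have "summable (\<lambda>n::nat. norm (exp (- c) ^ n))"
    using assms by (simp add: summable_geometric)
  then have "(\<lambda>n::nat. exp (- c) ^ n) summable_on UNIV"
    by (rule norm_summable_imp_summable_on)
  then show ?thesis by (simp add: exp_of_nat_mult[symmetric] mult.commute)
qed

lemma exp_abs_int_has_sum:
  assumes "c > 0"
  shows "((\<lambda>n::int. exp (- c * \<bar>real_of_int n\<bar>)) has_sum (1 + exp (-c)) / (1 - exp (-c))) UNIV"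
proof -
  let ?r = "exp (-c)"
  have r: "norm (complex_of_real ?r) < 1" using assms by simp
  have geo: "((\<lambda>n::nat. complex_of_real ?r ^ n) has_sum 1 / (1 - of_real ?r)) UNIV"
    using r geometric_sums[OF r] by (intro norm_summable_imp_has_sum) (auto simp: norm_power simp del: norm_of_real)
  have e: "complex_of_real (exp (- c * real n)) = of_real ?r ^ n" for n
    by (simp add: exp_of_nat_mult[symmetric] mult.commute flip: of_real_power)
  have "((\<lambda>n::int. complex_of_real (exp (- c * \<bar>real_of_int n\<bar>))) has_sum
      (of_real ?r * (1 / (1 - of_real ?r)) + 1 / (1 - of_real ?r))) UNIV"
  proof (rule has_sum_int)
    have "(\<lambda>n::nat. complex_of_real (exp (- c * \<bar>real_of_int (int n + 1)\<bar>))) = (\<lambda>n. of_real ?r * of_real ?r ^ n)"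
      using e[of "Suc n" for n] by (auto simp: add_ac fun_eq_iff)
    then show "((\<lambda>n::nat. complex_of_real (exp (- c * \<bar>real_of_int (int n + 1)\<bar>))) has_sum
      (of_real ?r * (1 / (1 - of_real ?r)))) UNIV"
      using has_sum_cmult_right[OF geo, of "of_real ?r"] by simp
    show "((\<lambda>n::nat. complex_of_real (exp (- c * \<bar>real_of_int (- int n)\<bar>))) has_sum 1 / (1 - of_real ?r)) UNIV"
      using geo e by simp
  qed
  moreover have "of_real ?r * (1 / (1 - of_real ?r)) + 1 / (1 - of_real ?r)
      = complex_of_real ((1 + ?r) / (1 - ?r))"
    using assms by (simp add: add_divide_distrib)
  ultimately show ?thesis
    using has_sum_of_real_iff by metis
qed

lemma exp_abs_int_summable_on:
  assumes "c > 0"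
  shows "(\<lambda>n::int. exp (- c * \<bar>real_of_int n\<bar>)) summable_on UNIV"
  using exp_abs_int_has_sum[OF assms] by (auto simp: summable_on_def)

text \<open>The terms with n nonzero sum to at most 2 A r / (1 - r) in norm, where r = exp (- c).
  This is below the central term 1 exactly when (2 A + 1) r < 1.\<close>

lemma infsum_int_neq_0:
  fixes f :: "int \<Rightarrow> complex"
  assumes f: "f 0 = 1" "\<And>n. n \<noteq> 0 \<Longrightarrow> norm (f n) \<le> A * exp (- c * \<bar>real_of_int n\<bar>)"
    and "A \<ge> 0" "c > 0" "(2 * A + 1) * exp (- c) < 1"
  shows "(\<Sum>\<^sub>\<infinity>n. f n) \<noteq> 0"
proof
  assume 0: "(\<Sum>\<^sub>\<infinity>n. f n) = 0"
  have single: "((\<lambda>n::int. if n = 0 then b else 0) has_sum b) UNIV" for b :: "'b :: {comm_monoid_add, t2_space}"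
    by (rule has_sum_finite_neutralI[of "{0}"]) auto
  have E: "((\<lambda>n::int. A * exp (- c * \<bar>real_of_int n\<bar>)) has_sum A * ((1 + exp (- c)) / (1 - exp (- c)))) UNIV"
    by (intro has_sum_cmult_right exp_abs_int_has_sum assms)
  have "(f has_sum infsum f UNIV) UNIV"
  proof (rule abs_summable_on_imp_has_sum)
    show "(\<lambda>n::int. A * exp (- c * \<bar>real_of_int n\<bar>) + (if n = 0 then 1 else 0)) summable_on UNIV"
      using has_sum_add[OF E single[of 1]] by (auto simp: summable_on_def)
    show "norm (f n) \<le> A * exp (- c * \<bar>real_of_int n\<bar>) + (if n = 0 then 1 else 0)" for n
      using f \<open>A \<ge> 0\<close> by (cases "n = 0") auto
  qed
  then have "(f has_sum 0) UNIV" using 0 by simp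
  then have "((\<lambda>n. f n - (if n = 0 then 1 else 0)) has_sum (0 - 1)) UNIV"
    by (rule has_sum_diff) (rule single)
  \<comment> \<open>The correction - A at 0 removes the central term of the majorant, so that it
    bounds \<open>f\<close> with its own central term removed.\<close>
  moreover have "((\<lambda>n::int. A * exp (- c * \<bar>real_of_int n\<bar>) + (if n = 0 then - A else 0)) has_sum
      (A * ((1 + exp (- c)) / (1 - exp (- c))) + - A)) UNIV"
    by (rule has_sum_add[OF E single])
  ultimately have "norm (0 - 1 :: complex) \<le> A * ((1 + exp (- c)) / (1 - exp (- c))) + - A"
    by (rule norm_infsum_le) (use f in auto)
  moreover have "1 - exp (- c) > 0" using assms by simp
  ultimately have "1 - exp (- c) \<le> A * (1 + exp (- c)) - A * (1 - exp (- c))"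
    by (simp add: field_simps)
  then show False using assms(5) by (simp add: algebra_simps)
qed

section \<open>Biorthogonality\<close>

text \<open>A character of the additive group of integers, unbounded unless Re t = 0. At - t it is
  the numerator of c in the overview.\<close>

definition chi :: "complex \<Rightarrow> int \<Rightarrow> complex" where
  "chi t l = (-1) powi l * exp (- 2 * of_real pi * of_int l * t)"

text \<open>The Fermi function (1 - tanh (pi z)) / 2: it tends to 0 at the right end of the real
  line and to 1 at the left end.\<close>

definition fermi :: "complex \<Rightarrow> complex" where
  "fermi z = 1 / (1 + exp (2 * of_real pi * z))"

lemma chi_0 [simp]: "chi t 0 = 1"
  by (simp add: chi_def)

lemma chi_add: "chi t (k + l) = chi t k * chi t l"
  by (simp add: chi_def power_int_add exp_add [symmetric] algebra_simps)

lemma chi_uminus: "chi t (- l) = chi (- t) l"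
  by (simp add: chi_def power_int_minus field_simps flip: power_int_inverse)

lemma chi_eq_power: "chi t (int n) = (- exp (- 2 * of_real pi * t)) ^ n"
  by (simp add: chi_def power_minus[of "exp _"] exp_of_nat_mult[symmetric] mult_ac)

lemma norm_chi: "norm (chi t l) = exp (- 2 * pi * of_int l * Re t)"
  by (simp add: chi_def norm_mult norm_power_int)

lemma one_plus_exp_neq_0:
  assumes "Re z \<noteq> 0"
  shows "1 + exp (2 * of_real pi * z) \<noteq> 0"
proof
  assume "1 + exp (2 * of_real pi * z) = 0"
  then have "exp (2 * of_real pi * z) = -1"
    by (metis add.commute eq_neg_iff_add_eq_0)
  then have "exp (2 * pi * Re z) = 1" using norm_exp_eq_Re[of "2 * of_real pi * z"] by simp
  then show False using assms by simp
qed

lemma fermi_uminus: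
  assumes "1 + exp (2 * of_real pi * z) \<noteq> 0"
  shows "fermi (- z) = 1 - fermi z"
  using assms unfolding fermi_def by (simp add: exp_minus field_simps)

lemma fermi_geometric:
  assumes "Re z > 0"
  shows "((\<lambda>j. (- exp (- 2 * of_real pi * z)) ^ Suc j) has_sum - fermi z) UNIV"
proof -
  let ?w = "- exp (- 2 * of_real pi * z)"
  have w: "norm ?w < 1" using assms by simp
  have "((\<lambda>j. ?w ^ j) has_sum 1 / (1 - ?w)) UNIV"
    using w geometric_sums[OF w] by (intro norm_summable_imp_has_sum) (auto simp: norm_power)
  then have "((\<lambda>j. ?w * ?w ^ j) has_sum ?w * (1 / (1 - ?w))) UNIV"
    by (rule has_sum_cmult_right)
  moreover have "1 + exp (2 * of_real pi * z) \<noteq> 0" using one_plus_exp_neq_0 assms by auto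
  then have "?w * (1 / (1 - ?w)) = - fermi z"
    by (simp add: fermi_def exp_minus field_simps)
  ultimately show ?thesis by simp
qed

section \<open>Lambert-type series and their symmetry\<close>

definition lambert :: "complex \<Rightarrow> complex" where
  "lambert t = (\<Sum>\<^sub>\<infinity>n::nat. chi t (int n + 1) * fermi (of_int (int n + 1) - t))"

text \<open>With L = l + 1, J = j + 1 and a = Re t, the exponent has real part - 2 pi (J L - (J - L)
  a), and J L - (J - L) a = (J + a) (L - a) + a^2. Both factors are positive because |a| < 1, whence
  absolute convergence. The part J L is symmetric in the indices and (J - L) t antisymmetric, so
  swapping them replaces t by - t.\<close>

lemma lambert_double_sum:
  fixes t :: complex
  assumes "\<bar>Re t\<bar> < 1"
  defines "f \<equiv> \<lambda>l j. (-1) ^ (Suc l + Suc j) * exp (2 * of_real pi * (of_nat (Suc j) - of_nat (Suc l)) * t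
       - 2 * of_real pi * of_nat (Suc j * Suc l))"
  shows "(\<lambda>(l, j). f l j) summable_on UNIV"
    and "((\<lambda>j. f l j) has_sum - (chi t (int l + 1) * fermi (of_int (int l + 1) - t))) UNIV"
proof -
  define c where "c = 2 * pi * (1 - \<bar>Re t\<bar>)\<^sup>2"
  have c: "c > 0" using assms by (simp add: c_def)
  have bd: "norm (f l j) \<le> exp (- c * real l) * exp (- c * real j)" for l j
  proof -
    define a where "a = Re t"
    define L J where "L = real (Suc l)" and "J = real (Suc j)"
    have a: "\<bar>a\<bar> < 1" using assms by (simp add: a_def)
    have LJ: "L \<ge> 1" "J \<ge> 1" by (auto simp: L_def J_def)
    have b1: "J + a \<ge> (1 - \<bar>a\<bar>) * J" "L - a \<ge> (1 - \<bar>a\<bar>) * L"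
      using mult_left_mono[OF LJ(1), of "\<bar>a\<bar>"] mult_left_mono[OF LJ(2), of "\<bar>a\<bar>"]
      by (auto simp: algebra_simps)
    \<comment> \<open>J L = (l + 1) (j + 1) exceeds l + j, which turns the bound into a product of
      two geometric ones.\<close>
    have "(1 - \<bar>a\<bar>)\<^sup>2 * (real l + real j) \<le> (1 - \<bar>a\<bar>)\<^sup>2 * (J * L)"
      by (rule mult_left_mono) (auto simp: L_def J_def algebra_simps)
    also have "\<dots> = ((1 - \<bar>a\<bar>) * J) * ((1 - \<bar>a\<bar>) * L)" by (simp add: power2_eq_square)
    also have "\<dots> \<le> (J + a) * (L - a)" using b1 a LJ by (intro mult_mono) auto
    also have "\<dots> \<le> J * L - (J - L) * a" by (simp add: algebra_simps)
    finally have "2 * pi * ((1 - \<bar>a\<bar>)\<^sup>2 * (real l + real j)) \<le> 2 * pi * (J * L - (J - L) * a)"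
      by (intro mult_left_mono) auto
    then have "2 * pi * (J - L) * a - 2 * pi * (J * L) \<le> - c * real l + - c * real j"
      by (simp add: c_def a_def algebra_simps)
    moreover have "norm (f l j) = exp (2 * pi * (J - L) * a - 2 * pi * (J * L))"
      unfolding f_def norm_mult norm_power norm_exp_eq_Re by (simp add: a_def L_def J_def algebra_simps)
    ultimately show ?thesis by (simp add: exp_add[symmetric])
  qed
  have "(\<lambda>(l::nat, j::nat). exp (- c * real l) * exp (- c * real j)) summable_on UNIV \<times> UNIV"
    by (intro nonneg_summable_on_Times exp_nat_summable_on c) auto
  then have "(\<lambda>p. norm ((\<lambda>(l, j). f l j) p)) summable_on UNIV \<times> UNIV"
    by (rule Infinite_Sum.abs_summable_on_comparison_test') (use bd in auto)
  then have "(\<lambda>(l, j). f l j) summable_on UNIV \<times> UNIV"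
    by (rule Infinite_Sum.abs_summable_summable)
  then show "(\<lambda>(l, j). f l j) summable_on UNIV" by simp
  let ?z = "of_int (int l + 1) - t"
  have "Re ?z > 0" using assms by simp
  from has_sum_cmult_right[OF fermi_geometric[OF this], of "chi t (int l + 1)"]
  have *: "((\<lambda>j. chi t (int l + 1) * (- exp (- 2 * of_real pi * ?z)) ^ Suc j)
     has_sum chi t (int l + 1) * - fermi ?z) UNIV" .
  have "chi t (int l + 1) * (- exp (- 2 * of_real pi * ?z)) ^ Suc j = f l j" for j
  proof -
    have p: "(- exp (- 2 * of_real pi * ?z)) ^ Suc j = (-1) ^ Suc j * exp (of_nat (Suc j) * (- 2 * of_real pi * ?z))"
      by (subst power_minus, subst exp_of_nat_mult) simp
    have q: "chi t (int l + 1) = (-1) ^ Suc l * exp (- 2 * of_real pi * of_nat (Suc l) * t)"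
      using chi_def[of t "int (Suc l)"] by (simp add: add_ac del: of_nat_Suc power_Suc) (simp add: add_ac)
    have w: "2 * of_real pi * (of_nat (Suc j) - of_nat (Suc l)) * t - 2 * of_real pi * of_nat (Suc j * Suc l)
        = - 2 * of_real pi * of_nat (Suc l) * t + of_nat (Suc j) * (- 2 * of_real pi * ?z)"
      by (simp add: algebra_simps)
    show ?thesis
      unfolding p q f_def w exp_add power_add by (simp only: mult_ac)
  qed
  with * show "((\<lambda>j. f l j) has_sum - (chi t (int l + 1) * fermi ?z)) UNIV"
    by simp
qed

lemma lambert_has_sum:
  assumes "\<bar>Re t\<bar> < 1"
  shows "((\<lambda>n::nat. chi t (int n + 1) * fermi (of_int (int n + 1) - t)) has_sum lambert t) UNIV"
proof -
  note d = lambert_double_sum[OF assms]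
  have "(\<lambda>l. - (chi t (int l + 1) * fermi (of_int (int l + 1) - t))) summable_on UNIV"
    unfolding infsumI[OF d(2), symmetric]
    by (rule summable_on_Sigma_banach) (use d(1) in simp)
  then show ?thesis
    unfolding lambert_def summable_on_uminus by (rule has_sum_infsum)
qed

text \<open>The double series of \<open>lambert_double_sum\<close> is mapped to the one for \<open>- t\<close> by exchanging the two indices.\<close>

lemma lambert_uminus:
  assumes "\<bar>Re t\<bar> < 1"
  shows "lambert (- t) = lambert t"
proof -
  have t': "\<bar>Re (- t)\<bar> < 1" using assms by simp
  note d = lambert_double_sum[OF assms] and d' = lambert_double_sum[OF t']
  have "- lambert t = (\<Sum>\<^sub>\<infinity>l::nat. - (chi t (int l + 1) * fermi (of_int (int l + 1) - t)))"
    by (simp add: lambert_def infsum_uminus)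
  also have "\<dots> = (\<Sum>\<^sub>\<infinity>l::nat. - (chi (- t) (int l + 1) * fermi (of_int (int l + 1) - - t)))"
    unfolding infsumI[OF d(2), symmetric] infsumI[OF d'(2), symmetric]
    by (subst infsum_swap_banach) (use d(1) in \<open>auto simp: algebra_simps\<close>)
  also have "\<dots> = - lambert (- t)"
    by (simp add: lambert_def infsum_uminus)
  finally show ?thesis by simp
qed

text \<open>
  For \<open>Re t \<ge> 0\<close> the series over \<open>chi t l * fermi (l - t)\<close> diverges as \<open>l \<rightarrow> -\<infinity>\<close>, where \<open>fermi\<close> tends to 1;
  subtracting this limit gives convergence in the whole strip.
\<close>

lemma chi_fermi_regularized_has_sum:
  assumes "\<bar>Re t\<bar> < 1" "1 + exp (2 * of_real pi * t) \<noteq> 0"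
  shows "((\<lambda>l. chi t l * (fermi (of_int l - t) - (if l \<le> 0 then 1 else 0))) has_sum - fermi t) UNIV"
    (is "(?f has_sum _) UNIV")
proof -
  have pos: "((\<lambda>n. ?f (int n + 1)) has_sum lambert t) UNIV"
    using lambert_has_sum[OF assms(1)] by simp
  have f_neg: "?f (- int n) = - (chi (- t) (int n) * fermi (of_int (int n) - - t))" for n
  proof -
    \<comment> \<open>For n = 0 this is the second hypothesis; for n > 0 the real part n + Re t is
      positive.\<close>
    have "1 + exp (2 * of_real pi * (of_nat n + t)) \<noteq> 0"
      using assms by (cases n) (auto intro!: one_plus_exp_neq_0)
    from fermi_uminus[OF this] have "fermi (of_int (- int n) - t) = 1 - fermi (of_int (int n) - - t)"
      by simp
    then show ?thesis by (simp add: chi_uminus)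
  qed
  have "((\<lambda>n. - (chi (- t) (int n + 1) * fermi (of_int (int n + 1) - - t))) has_sum - lambert (- t)) UNIV"
    using lambert_has_sum[of "- t"] assms by (simp add: has_sum_uminus)
  then have "((\<lambda>n. ?f (- int (Suc n))) has_sum - lambert (- t)) UNIV"
    unfolding f_neg by (simp add: add_ac)
  \<comment> \<open>The term at l = 0 belongs to the nonpositive half. It equals -
    \<open>fermi t\<close> and is all that survives when \<open>lambert t\<close> cancels against
    \<open>lambert (- t)\<close>.\<close>
  from has_sum_nat_Suc[where f = "\<lambda>n. ?f (- int n)", OF this]
  have "((\<lambda>n. ?f (- int n)) has_sum (?f (- int 0) - lambert (- t))) UNIV" by simp
  also have "?f (- int 0) = - fermi t" using f_neg[of 0] by simp
  finally have neg: "((\<lambda>n. ?f (- int n)) has_sum (- fermi t - lambert t)) UNIV"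
    using lambert_uminus[OF assms(1)] by simp
  from has_sum_int[OF pos neg] show ?thesis by simp
qed

text \<open>For Re t < 0 the subtracted part, the sum of \<open>chi t l\<close> over l at most 0, is
  itself a convergent geometric series with value \<open>fermi t\<close>. Adding it back cancels the
  regularized value - \<open>fermi t\<close>.\<close>

lemma chi_fermi_has_sum_0:
  assumes "-1 < Re t" "Re t < 0"
  shows "((\<lambda>l. chi t l * fermi (of_int l - t)) has_sum 0) UNIV"
proof -
  let ?g = "\<lambda>l::int. chi t l * (if l \<le> 0 then 1 else 0)"
  have nz: "1 + exp (2 * of_real pi * t) \<noteq> 0" using assms by (intro one_plus_exp_neq_0) auto
  let ?w = "- exp (2 * of_real pi * t)"
  have w: "norm ?w < 1" using assms by (simp add: mult_pos_neg)
  have "((\<lambda>j. ?w ^ j) has_sum 1 / (1 - ?w)) UNIV"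
    using w geometric_sums[OF w] by (intro norm_summable_imp_has_sum) (auto simp: norm_power)
  then have "((\<lambda>n. ?g (- int n)) has_sum fermi t) UNIV"
    by (simp add: chi_uminus chi_eq_power fermi_def)
  moreover have "((\<lambda>n. ?g (int n + 1)) has_sum 0) UNIV" by simp
  ultimately have "(?g has_sum (0 + fermi t)) UNIV" by (intro has_sum_int)
  from has_sum_add[OF this chi_fermi_regularized_has_sum[OF _ nz]] assms
  show ?thesis by (simp add: algebra_simps)
qed

section \<open>Partial fractions and orthogonality of shifted hyperbolic secants\<close>

definition sech_term :: "complex \<Rightarrow> int \<Rightarrow> complex" where
  "sech_term t l = 1 / cosh (of_real pi * (of_int l - t))"

lemma cosh_conv_exp:
  fixes z :: complex
  shows "cosh (of_real pi * z) = (1 + exp (2 * of_real pi * z)) / (2 * exp (of_real pi * z))"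
proof -
  have "exp (2 * of_real pi * z) = exp (of_real pi * z) ^ 2"
    by (simp add: mult_ac flip: exp_double)
  then show ?thesis
    by (simp add: cosh_field_def exp_minus field_simps power2_eq_square)
qed

text \<open>The addition formula tanh x - tanh y = sinh (x - y) / (cosh x cosh y), written with
  \<open>fermi\<close> in place of tanh.\<close>

lemma sech_mult_sech:
  assumes "1 + exp (2 * of_real pi * z) \<noteq> 0" "1 + exp (2 * of_real pi * w) \<noteq> 0"
  shows "sinh (of_real pi * (z - w)) * (1 / cosh (of_real pi * z) * (1 / cosh (of_real pi * w)))
         = 2 * (fermi w - fermi z)"
proof -
  define P Q where "P = exp (of_real pi * z)" and "Q = exp (of_real pi * w)"
  have [simp]: "P \<noteq> 0" "Q \<noteq> 0" by (auto simp: P_def Q_def)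
  have P2: "exp (2 * of_real pi * z) = P\<^sup>2" and Q2: "exp (2 * of_real pi * w) = Q\<^sup>2"
    by (simp_all add: P_def Q_def mult_ac flip: exp_double)
  have nz: "1 + P\<^sup>2 \<noteq> 0" "1 + Q\<^sup>2 \<noteq> 0" using assms P2 Q2 by auto
  have s: "sinh (of_real pi * (z - w)) = (P / Q - Q / P) / 2"
    by (simp add: sinh_field_def P_def Q_def exp_diff right_diff_distrib exp_minus)
  have "sinh (of_real pi * (z - w)) * (1 / cosh (of_real pi * z) * (1 / cosh (of_real pi * w)))
      = (P / Q - Q / P) / 2 * (2 * P / (1 + P\<^sup>2) * (2 * Q / (1 + Q\<^sup>2)))"
    unfolding s cosh_conv_exp P2 Q2 by (simp add: P_def Q_def)
  also have "\<dots> = 2 * (P\<^sup>2 - Q\<^sup>2) / ((1 + P\<^sup>2) * (1 + Q\<^sup>2))"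
    using nz by (simp add: divide_simps power2_eq_square)
  also have "\<dots> = 2 * (1 / (1 + Q\<^sup>2) - 1 / (1 + P\<^sup>2))"
    using nz by (simp add: divide_simps)
  finally show ?thesis by (simp add: fermi_def P2 Q2)
qed

lemma one_plus_exp_real_neq_0:
  assumes "z \<in> \<real>"
  shows "1 + exp (2 * of_real pi * z) \<noteq> 0"
proof -
  from assms obtain x where x: "z = of_real x" by (auto elim: Reals_cases)
  have "1 + exp (2 * of_real pi * z) = of_real (1 + exp (2 * pi * x))"
    by (simp add: x flip: exp_of_real)
  moreover have "1 + exp (2 * pi * x) > 0" by (simp add: add_pos_pos)
  ultimately show ?thesis by (metis less_irrefl of_real_eq_0_iff)
qed

text \<open>The difference of the two step functions has finite support, so this is a finite
  geometric sum. It pays for moving the cutoff of the regularization from 0 to k.\<close>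

lemma chi_step_has_sum:
  assumes "t \<in> \<real>"
  shows "((\<lambda>l. chi t l * ((if l \<le> k then 1 else 0) - (if l \<le> 0 then 1 else 0)))
      has_sum (fermi t * (chi t k - 1))) UNIV"
proof (induction k rule: int_induct[where k = 0])
  case base
  show ?case by simp
next
  have single: "((\<lambda>l::int. if l = m then c else 0) has_sum c) UNIV" for m and c :: complex
    by (rule has_sum_finite_neutralI[of "{m}"]) auto
  \<comment> \<open>The ratio \<open>chi t i\<close> / \<open>chi t (i + 1)\<close> is - exp (2 pi
    t), so the difference carries exactly the denominator of \<open>fermi t\<close>; hence the sum
    telescopes.\<close>
  have chi1: "fermi t * (chi t (i + 1) - chi t i) = chi t (i + 1)" for i
  proof -
    have "chi t i = - exp (2 * of_real pi * t) * chi t (i + 1)"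
      using chi_add[of t "i + 1" "-1"] chi_add[of t "-1" "1"] chi_eq_power[of "- t" 1]
      by (simp add: chi_uminus mult_ac)
    then have "chi t (i + 1) - chi t i = (1 + exp (2 * of_real pi * t)) * chi t (i + 1)"
      by (simp add: algebra_simps)
    then show ?thesis using one_plus_exp_real_neq_0[OF assms] by (simp add: fermi_def)
  qed
  {
    case (step1 i)
    from has_sum_add[OF step1(2) single[of "i + 1" "chi t (i + 1)"]]
    have "((\<lambda>l. chi t l * ((if l \<le> i then 1 else 0) - (if l \<le> 0 then 1 else 0)) + (if l = i + 1 then chi t (i + 1) else 0))
       has_sum (fermi t * (chi t i - 1) + fermi t * (chi t (i + 1) - chi t i))) UNIV" by (simp only: chi1)
    also have "fermi t * (chi t i - 1) + fermi t * (chi t (i + 1) - chi t i) = fermi t * (chi t (i + 1) - 1)"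
      by (simp add: algebra_simps)
    finally show ?case
      by (rule has_sum_cong[THEN iffD1, rotated]) auto
  next
    case (step2 i)
    from has_sum_diff[OF step2(2) single[of i "chi t i"]]
    have "((\<lambda>l. chi t l * ((if l \<le> i then 1 else 0) - (if l \<le> 0 then 1 else 0)) - (if l = i then chi t i else 0))
       has_sum (fermi t * (chi t i - 1) - fermi t * (chi t i - chi t (i - 1)))) UNIV" using chi1[of "i - 1"] by simp
    also have "fermi t * (chi t i - 1) - fermi t * (chi t i - chi t (i - 1)) = fermi t * (chi t (i - 1) - 1)"
      by (simp add: algebra_simps)
    finally show ?case
      by (rule has_sum_cong[THEN iffD1, rotated]) auto
  }
qed

text \<open>Reindexing by k multiplies the sum - \<open>fermi t\<close> by \<open>chi t k\<close>
  and moves the cutoff to k. Moving it back adds \<open>fermi t * (chi t k - 1)\<close>, which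
  restores - \<open>fermi t\<close>: the value does not depend on k.\<close>

lemma chi_fermi_shift_has_sum:
  assumes "t \<in> \<real>" "\<bar>Re t\<bar> < 1"
  shows "((\<lambda>l. chi t l * (fermi (of_int (l - k) - t) - (if l \<le> 0 then 1 else 0))) has_sum - fermi t) UNIV"
proof -
  have b: "bij_betw (\<lambda>l::int. l - k) UNIV UNIV"
    by (rule bij_betwI[of _ _ _ "\<lambda>l. l + k"]) auto
  have "((\<lambda>l. chi t l * (fermi (of_int l - t) - (if l \<le> 0 then 1 else 0))) has_sum - fermi t) UNIV"
    using assms by (intro chi_fermi_regularized_has_sum one_plus_exp_real_neq_0) auto
  then have "((\<lambda>l. chi t (l - k) * (fermi (of_int (l - k) - t) - (if l - k \<le> 0 then 1 else 0))) has_sum - fermi t) UNIV"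
    by (subst (asm) has_sum_reindex_bij_betw[OF b, symmetric])
  from has_sum_add[OF has_sum_cmult_right[OF this, of "chi t k"] chi_step_has_sum[OF assms(1), of k]]
  have "((\<lambda>l. chi t k * (chi t (l - k) * (fermi (of_int (l - k) - t) - (if l - k \<le> 0 then 1 else 0)))
      + chi t l * ((if l \<le> k then 1 else 0) - (if l \<le> 0 then 1 else 0)))
      has_sum - fermi t) UNIV"
    by (simp add: algebra_simps)
  then show ?thesis
  proof (rule has_sum_cong[THEN iffD1, rotated])
    fix l
    have "chi t l = chi t k * chi t (l - k)"
      using chi_add[of t k "l - k"] by simp
    then show "chi t k * (chi t (l - k) * (fermi (of_int (l - k) - t) - (if l - k \<le> 0 then 1 else 0)))
      + chi t l * ((if l \<le> k then 1 else 0) - (if l \<le> 0 then 1 else 0))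
      = chi t l * (fermi (of_int (l - k) - t) - (if l \<le> 0 then 1 else 0))"
      by (simp add: algebra_simps)
  qed
qed

text \<open>By partial fractions the summand is a multiple of the difference of two regularized
  terms, for the shifts k and 0. Their sums agree and the common cutoff drops out. The multiplier 2
  / sinh (pi k) is what excludes k = 0.\<close>

lemma sech_orthogonality:
  assumes "t \<in> \<real>" "\<bar>Re t\<bar> < 1" "k \<noteq> 0"
  shows "((\<lambda>l. chi t l * sech_term t l * sech_term t (l - k)) has_sum 0) UNIV"
proof -
  from has_sum_diff[OF chi_fermi_shift_has_sum[OF assms(1,2), of k] chi_fermi_shift_has_sum[OF assms(1,2), of 0]]
  have "((\<lambda>l. chi t l * (fermi (of_int (l - k) - t) - fermi (of_int l - t))) has_sum 0) UNIV"
    by (simp add: algebra_simps)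
  from has_sum_cmult_right[OF this, of "2 / sinh (of_real (pi * of_int k))"]
  have "((\<lambda>l. 2 / sinh (of_real (pi * of_int k)) * (chi t l * (fermi (of_int (l - k) - t) - fermi (of_int l - t)))) has_sum 0) UNIV"
    by simp
  then show ?thesis
  proof (rule has_sum_cong[THEN iffD1, rotated])
    fix l
    have nz: "1 + exp (2 * of_real pi * (of_int m - t)) \<noteq> 0" for m
      by (intro one_plus_exp_real_neq_0 Reals_diff assms(1)) simp
    have "sinh (complex_of_real (pi * of_int k)) = of_real (sinh (pi * of_int k))"
      by (simp add: sinh_field_def flip: exp_of_real)
    then have sk: "sinh (complex_of_real (pi * of_int k)) \<noteq> 0"
      using assms by (simp del: of_real_mult)
    have "sinh (of_real (pi * of_int k)) * (sech_term t l * sech_term t (l - k))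
        = 2 * (fermi (of_int (l - k) - t) - fermi (of_int l - t))"
      using sech_mult_sech[OF nz[of l] nz[of "l - k"]]
      by (simp add: sech_term_def algebra_simps)
    then have "sech_term t l * sech_term t (l - k)
      = 2 / sinh (of_real (pi * of_int k)) * (fermi (of_int (l - k) - t) - fermi (of_int l - t))"
      using sk by (simp add: field_simps)
    then show "2 / sinh (of_real (pi * of_int k)) * (chi t l * (fermi (of_int (l - k) - t) - fermi (of_int l - t)))
       = chi t l * sech_term t l * sech_term t (l - k)"
      by (simp add: mult_ac)
  qed
qed

section \<open>Exponential bounds and the convolution\<close>

lemma norm_inverse_cosh_le:
  assumes "\<delta> > 0" "\<bar>Re z\<bar> \<ge> \<delta>"
  shows "norm (1 / cosh (of_real pi * z)) \<le> 2 / (1 - exp (- 2 * pi * \<delta>)) * exp (- pi * \<bar>Re z\<bar>)"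
proof -
  let ?x = "pi * \<bar>Re z\<bar>"
  have d: "1 - exp (- 2 * pi * \<delta>) > 0" using assms by simp
  \<comment> \<open>Complex cosh has zeros on the imaginary axis, so the bound must degenerate as
    \<open>\<delta>\<close> tends to 0. It rests on |e^w + e^-w| being at least the difference of
    the two moduli.\<close>
  have "exp ?x * (1 - exp (- 2 * pi * \<delta>)) \<le> exp ?x * (1 - exp (- 2 * ?x))"
    using assms by (intro mult_left_mono) auto
  also have "\<dots> = exp ?x - exp (- ?x)"
    by (simp add: right_diff_distrib flip: exp_add)
  also have "\<dots> \<le> norm (exp (of_real pi * z) + exp (- (of_real pi * z)))"
    using norm_diff_ineq[of "exp (of_real pi * z)" "exp (- (of_real pi * z))"]
          norm_diff_ineq[of "exp (- (of_real pi * z))" "exp (of_real pi * z)"]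
    by (cases "Re z \<ge> 0") (auto simp: add.commute)
  also have "\<dots> = 2 * norm (cosh (of_real pi * z))"
    by (simp add: cosh_field_def norm_divide)
  finally have *: "exp ?x * (1 - exp (- 2 * pi * \<delta>)) \<le> 2 * norm (cosh (of_real pi * z))" .
  moreover have "exp ?x * (1 - exp (- 2 * pi * \<delta>)) > 0" using d by simp
  ultimately have "norm (cosh (of_real pi * z)) > 0" by linarith
  then show ?thesis using * d by (simp add: norm_divide exp_minus divide_simps mult_ac)
qed

lemma norm_inverse_cosh_real_le:
  "norm (1 / cosh (of_real pi * complex_of_real x)) \<le> 2 * exp (- pi * \<bar>x\<bar>)"
proof -
  have c: "cosh (of_real pi * complex_of_real x) = of_real (cosh (pi * x))"
    by (simp add: cosh_field_def flip: exp_of_real)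
  have "exp (pi * \<bar>x\<bar>) \<le> 2 * cosh (pi * x)"
    by (cases "x \<ge> 0") (simp_all add: cosh_field_def)
  moreover have "cosh (pi * x) > 0" by (rule cosh_real_pos)
  ultimately show ?thesis unfolding c by (simp add: norm_divide exp_minus divide_simps)
qed

lemma norm_sech_term_real_le:
  assumes "t \<in> \<real>"
  shows "norm (sech_term t l) \<le> 2 * exp (pi * \<bar>Re t\<bar>) * exp (- pi * \<bar>real_of_int l\<bar>)"
proof -
  from assms obtain x where t: "t = of_real x" by (auto elim: Reals_cases)
  have "norm (sech_term t l) \<le> 2 * exp (- pi * \<bar>of_int l - x\<bar>)"
    using norm_inverse_cosh_real_le[of "of_int l - x"] by (simp add: sech_term_def t)
  also have "\<dots> \<le> 2 * exp (pi * \<bar>x\<bar> + - pi * \<bar>real_of_int l\<bar>)"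
    using mult_left_mono[of "\<bar>real_of_int l\<bar>" "\<bar>of_int l - x\<bar> + \<bar>x\<bar>" pi] by (simp add: algebra_simps)
  also have "\<dots> = 2 * exp (pi * \<bar>Re t\<bar>) * exp (- pi * \<bar>real_of_int l\<bar>)"
    unfolding exp_add by (simp add: t)
  finally show ?thesis .
qed

text \<open>The sequence c of the overview. Writing it through - t lets the estimates for
  \<open>chi\<close> and \<open>sech_term\<close> serve twice.\<close>

definition dual_term :: "complex \<Rightarrow> int \<Rightarrow> complex" where
  "dual_term t m = chi (- t) m * sech_term (- t) m"

lemma norm_dual_term_le:
  assumes "t \<in> \<real>"
  shows "norm (dual_term t m) \<le> 2 * exp (pi * \<bar>Re t\<bar>) * exp (- (pi * (1 - 2 * \<bar>Re t\<bar>)) * \<bar>real_of_int m\<bar>)"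
proof -
  have "of_int m * Re t \<le> \<bar>real_of_int m\<bar> * \<bar>Re t\<bar>"
    by (metis abs_ge_self abs_mult)
  from mult_left_mono[OF this, of "2 * pi"]
  have "norm (chi (- t) m) \<le> exp (2 * pi * \<bar>real_of_int m\<bar> * \<bar>Re t\<bar>)"
    by (simp add: norm_chi mult_ac)
  moreover have "norm (sech_term (- t) m) \<le> 2 * exp (pi * \<bar>Re t\<bar>) * exp (- pi * \<bar>real_of_int m\<bar>)"
    using norm_sech_term_real_le[of "- t" m] assms by simp
  ultimately have "norm (dual_term t m) \<le>
     exp (2 * pi * \<bar>real_of_int m\<bar> * \<bar>Re t\<bar>) * (2 * exp (pi * \<bar>Re t\<bar>) * exp (- pi * \<bar>real_of_int m\<bar>))"
    unfolding dual_term_def norm_mult by (intro mult_mono) auto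
  also have "\<dots> = 2 * exp (pi * \<bar>Re t\<bar>) * (exp (2 * pi * \<bar>real_of_int m\<bar> * \<bar>Re t\<bar>) * exp (- pi * \<bar>real_of_int m\<bar>))"
    by simp
  also have "exp (2 * pi * \<bar>real_of_int m\<bar> * \<bar>Re t\<bar>) * exp (- pi * \<bar>real_of_int m\<bar>)
     = exp (- (pi * (1 - 2 * \<bar>Re t\<bar>)) * \<bar>real_of_int m\<bar>)"
    by (simp add: algebra_simps flip: exp_add)
  finally show ?thesis .
qed

lemma dual_term_shift: "dual_term t (k - l) = chi (- t) k * (chi t l * sech_term t (l - k))"
proof -
  have "chi (- t) (k - l) = chi (- t) k * chi t l"
    using chi_add[of "- t" k "- l"] by (simp add: chi_uminus)
  moreover have "sech_term (- t) (k - l) = sech_term t (l - k)"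
    unfolding sech_term_def
    by (subst cosh_minus[symmetric]) (simp add: algebra_simps)
  ultimately show ?thesis by (simp add: dual_term_def)
qed

text \<open>The absolutely convergent double sum is evaluated twice: by rows it is the product of
  the two series, and along the antidiagonals k = l + m only k = 0 survives, by orthogonality. Here
  \<open>e\<close> stands for a unitary character such as l -> exp (- 2 pi i l nu).\<close>

lemma sech_dual_convolution:
  fixes e :: "int \<Rightarrow> complex"
  assumes t: "t \<in> \<real>" "\<bar>Re t\<bar> < 1/2"
    and e: "\<And>k l. e (k + l) = e k * e l" "\<And>k. norm (e k) = 1" "e 0 = 1"
  shows "(\<Sum>\<^sub>\<infinity>l. sech_term t l * e l) * (\<Sum>\<^sub>\<infinity>m. dual_term t m * e m)
       = (\<Sum>\<^sub>\<infinity>l. chi t l * (sech_term t l)\<^sup>2)"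
proof -
  define C where "C = 2 * exp (pi * \<bar>Re t\<bar>)"
  define c where "c = pi * (1 - 2 * \<bar>Re t\<bar>)"
  have c: "c > 0" using t by (simp add: c_def)
  have C: "C > 0" by (simp add: C_def)
  define A where "A = (\<lambda>l::int. C * exp (- pi * \<bar>real_of_int l\<bar>))"
  define D where "D = (\<lambda>l::int. C * exp (- c * \<bar>real_of_int l\<bar>))"
  have A: "A summable_on UNIV" "\<And>l. A l \<ge> 0" "\<And>l. norm (sech_term t l) \<le> A l"
    unfolding A_def using norm_sech_term_real_le[OF t(1)] C exp_abs_int_summable_on[of pi]
    by (auto simp: C_def intro!: summable_on_cmult_right)
  have D: "D summable_on UNIV" "\<And>l. D l \<ge> 0" "\<And>l. norm (dual_term t l) \<le> D l"
    unfolding D_def using norm_dual_term_le[OF t(1)] C exp_abs_int_summable_on[OF c]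
    by (auto simp: C_def c_def intro!: summable_on_cmult_right)
  define F H where "F = (\<Sum>\<^sub>\<infinity>l. sech_term t l * e l)" and "H = (\<Sum>\<^sub>\<infinity>m. dual_term t m * e m)"
  have F: "((\<lambda>l. sech_term t l * e l) has_sum F) UNIV"
    unfolding F_def by (rule abs_summable_on_imp_has_sum[OF A(1)]) (simp add: norm_mult e A(3))
  have H: "((\<lambda>m. dual_term t m * e m) has_sum H) UNIV"
    unfolding H_def by (rule abs_summable_on_imp_has_sum[OF D(1)]) (simp add: norm_mult e D(3))
  let ?p = "\<lambda>(l, m). (sech_term t l * e l) * (dual_term t m * e m)"
  define T where "T = infsum ?p (UNIV \<times> UNIV)"
  have p: "(?p has_sum T) (UNIV \<times> UNIV)"
    unfolding T_def
  proof (rule abs_summable_on_imp_has_sum)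
    show "(\<lambda>(l, m). A l * D m) summable_on UNIV \<times> UNIV"
      using A D by (intro nonneg_summable_on_Times)
  qed (use A D in \<open>auto simp: norm_mult e intro!: mult_mono\<close>)
  have "((\<lambda>l. (sech_term t l * e l) * H) has_sum T) UNIV"
    by (rule has_sum_SigmaD[OF p]) (use has_sum_cmult_right[OF H] in simp)
  moreover have "((\<lambda>l. (sech_term t l * e l) * H) has_sum (F * H)) UNIV"
    by (rule has_sum_cmult_left[OF F])
  ultimately have T1: "T = F * H" by (rule has_sum_unique)
  have bij: "bij_betw (\<lambda>(k, l). (l, k - l)) (UNIV \<times> UNIV) (UNIV \<times> (UNIV :: int set))"
    by (rule bij_betwI[of _ _ _ "\<lambda>(l, m). (l + m, l)"]) auto
  define S where "S = (\<Sum>\<^sub>\<infinity>l. chi t l * (sech_term t l)\<^sup>2)"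
  have S: "((\<lambda>l. chi t l * (sech_term t l)\<^sup>2) has_sum S) UNIV"
    unfolding S_def
  proof (rule abs_summable_on_imp_has_sum)
    show "(\<lambda>l. D l * C) summable_on UNIV"
      using D(1) by (rule summable_on_cmult_left)
    fix l :: int
    \<comment> \<open>\<open>dual_term (- t) l\<close> is \<open>chi t l * sech_term t l\<close>, so
      it supplies the character and one of the two secants in the summand of
      \<open>S\<close>.\<close>
    have "norm (dual_term (- t) l) \<le> D l"
      using norm_dual_term_le[of "- t" l] t by (simp add: D_def C_def c_def)
    moreover have "norm (sech_term t l) \<le> C"
    proof -
      have "A l \<le> C * 1" unfolding A_def using C by (intro mult_left_mono) auto
      with A(3)[of l] show ?thesis by simp
    qed
    ultimately have "norm (dual_term (- t) l * sech_term t l) \<le> D l * C"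
      unfolding norm_mult using D(2) by (intro mult_mono) auto
    then show "norm (chi t l * (sech_term t l)\<^sup>2) \<le> D l * C"
      by (simp add: dual_term_def power2_eq_square mult_ac)
  qed
  have "((\<lambda>(k, l). ?p (l, k - l)) has_sum T) (UNIV \<times> UNIV)"
    using p has_sum_reindex_bij_betw[OF bij, of ?p T] by (simp add: case_prod_unfold)
  then have "((\<lambda>k::int. if k = 0 then S else 0) has_sum T) UNIV"
  proof (rule has_sum_SigmaD)
    fix k :: int
    have eq: "sech_term t l * e l * (dual_term t (k - l) * e (k - l)) = e k * chi (- t) k * (chi t l * sech_term t l * sech_term t (l - k))" for l
      using e(1)[of l "k - l"] by (simp add: dual_term_shift mult_ac)
    show "((\<lambda>l. case (k, l) of (k, l) \<Rightarrow> ?p (l, k - l)) has_sum (if k = 0 then S else 0)) UNIV"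
    proof (cases "k = 0")
      case True
      with S show ?thesis unfolding split eq by (simp add: e power2_eq_square mult_ac)
    next
      case False
      have "\<bar>Re t\<bar> < 1" using t by simp
      from has_sum_cmult_right[OF sech_orthogonality[OF t(1) this False], of "e k * chi (- t) k"] False
      show ?thesis unfolding split eq by simp
    qed
  qed
  moreover have "((\<lambda>k::int. if k = 0 then S else 0) has_sum S) UNIV"
    by (rule has_sum_finite_neutralI[of "{0}"]) auto
  ultimately have "T = S" by (rule has_sum_unique)
  with T1 show ?thesis by (simp add: F_def H_def S_def)
qed

section \<open>The theta function\<close>

text \<open>A locally uniform Weierstrass test: the finite partial sums are holomorphic and converge
  uniformly on a small closed disc about each point.\<close>

lemma holomorphic_on_infsum:
  fixes f :: "'a \<Rightarrow> complex \<Rightarrow> complex"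
  assumes "open S" "\<And>x. x \<in> X \<Longrightarrow> f x holomorphic_on S"
    and M: "\<And>z. z \<in> S \<Longrightarrow> \<exists>r>0. \<exists>M. M summable_on X \<and> (\<forall>x\<in>X. \<forall>w\<in>cball z r. norm (f x w) \<le> M x)"
  shows "(\<lambda>z. \<Sum>\<^sub>\<infinity>x\<in>X. f x z) holomorphic_on S"
proof -
  have "\<exists>r>0. (\<lambda>z. \<Sum>\<^sub>\<infinity>x\<in>X. f x z) holomorphic_on ball z r" if "z \<in> S" for z
  proof -
    from M[OF that] obtain r M where r: "r > 0" and Ms: "M summable_on X"
      and le: "\<And>x w. x \<in> X \<Longrightarrow> w \<in> cball z r \<Longrightarrow> norm (f x w) \<le> M x" by blast
    from assms(1) that obtain r' where r': "r' > 0" "cball z r' \<subseteq> S"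
      by (meson open_contains_cball)
    define \<rho> where "\<rho> = min r r'"
    have rho: "\<rho> > 0" "cball z \<rho> \<subseteq> S" "cball z \<rho> \<subseteq> cball z r"
      using r r' by (auto simp: \<rho>_def)
    have ulim: "uniform_limit (cball z \<rho>) (\<lambda>Y w. \<Sum>x\<in>Y. f x w) (\<lambda>w. \<Sum>\<^sub>\<infinity>x\<in>X. f x w) (finite_subsets_at_top X)"
      by (rule Weierstrass_m_test_general[OF _ Ms]) (use le rho in blast)
    have "\<forall>\<^sub>F Y in finite_subsets_at_top X. continuous_on (cball z \<rho>) (\<lambda>w. \<Sum>x\<in>Y. f x w)
        \<and> (\<lambda>w. \<Sum>x\<in>Y. f x w) holomorphic_on ball z \<rho>"
    proof (rule eventually_finite_subsets_at_top_weakI)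
      fix Y assume "finite Y" "Y \<subseteq> X"
      then have hol: "(\<lambda>w. \<Sum>x\<in>Y. f x w) holomorphic_on S"
        using assms(2) by (intro holomorphic_on_sum) auto
      with rho show "continuous_on (cball z \<rho>) (\<lambda>w. \<Sum>x\<in>Y. f x w)
        \<and> (\<lambda>w. \<Sum>x\<in>Y. f x w) holomorphic_on ball z \<rho>"
        by (meson ball_subset_cball dual_order.trans holomorphic_on_imp_continuous_on holomorphic_on_subset)
    qed
    from holomorphic_uniform_limit[OF this ulim] rho(1) show ?thesis by auto
  qed
  then show ?thesis
    by (metis (no_types, lifting) assms(1) centre_in_ball field_differentiable_at_within holomorphic_on_def 
        holomorphic_on_imp_differentiable_at open_ball)
qed

text \<open>For the nome exp (- pi), scaling the argument by pi makes 1 and i the quasi-periods, so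
  the lattice is the square one.\<close>

definition Theta :: "complex \<Rightarrow> complex" where
  "Theta z = theta4 (of_real pi * z) (exp (- pi))"

definition theta_term :: "int \<Rightarrow> complex \<Rightarrow> complex" where
  "theta_term n z = (-1) powi n * exp (2 * of_real pi * \<i> * of_int n * z - of_real pi * (of_int n)\<^sup>2)"

lemma exp_minus_pi_powr: "complex_of_real (exp (- pi) powr x) = exp (of_real (- pi * x))"
  unfolding exp_of_real by (simp add: powr_def mult.commute del: ln_exp) (simp add: exp_minus ln_inverse)

lemma Theta_eq_infsum: "Theta z = (\<Sum>\<^sub>\<infinity>n. theta_term n z)"
  unfolding Theta_def theta4_def theta_term_def exp_minus_pi_powr
  by (intro infsum_cong) (simp add: mult_ac flip: exp_add)

text \<open>With m = |n| and B = 2 pi R + 1, the exponent is at most 2 pi R m - m^2 = m B - m - m^2,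
  and m B is at most m^2 + B^2. The constant B^2 is uniform on the disc of radius R, as the
  Weierstrass test requires.\<close>

lemma norm_theta_term_le:
  assumes "norm z \<le> R"
  shows "norm (theta_term n z) \<le> exp ((2 * pi * R + 1)\<^sup>2) * exp (- 1 * \<bar>real_of_int n\<bar>)"
proof -
  define m where "m = \<bar>real_of_int n\<bar>"
  have "norm (theta_term n z) = exp (- 2 * pi * of_int n * Im z - pi * (of_int n)\<^sup>2)"
    by (simp add: theta_term_def norm_mult norm_power_int power2_eq_square)
  also have "- 2 * pi * of_int n * Im z \<le> 2 * pi * (m * R)"
  proof -
    have "\<bar>of_int n * Im z\<bar> \<le> m * R"
      unfolding abs_mult m_def using assms abs_Im_le_cmod[of z] by (intro mult_left_mono) auto
    then have "2 * pi * (- (of_int n * Im z)) \<le> 2 * pi * (m * R)" by (intro mult_left_mono) auto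
    then show ?thesis by simp
  qed
  then have "- 2 * pi * of_int n * Im z - pi * (of_int n)\<^sup>2 \<le> (2 * pi * R + 1)\<^sup>2 + - 1 * m"
  proof -
    have "m\<^sup>2 \<le> pi * m\<^sup>2" using pi_ge_two mult_right_mono[of 1 pi "m\<^sup>2"] by simp
    moreover have "(of_int n)\<^sup>2 = m\<^sup>2" by (simp add: m_def)
    moreover have "m * (2 * pi * R + 1) \<le> m\<^sup>2 + (2 * pi * R + 1)\<^sup>2"
      using sum_squares_bound[of m "2 * pi * R + 1"] zero_le_power2[of m] zero_le_power2[of "2 * pi * R + 1"]
      by linarith
    ultimately show ?thesis
      using \<open>- 2 * pi * of_int n * Im z \<le> 2 * pi * (m * R)\<close> by (simp add: algebra_simps)
  qed
  finally show ?thesis by (simp add: m_def flip: exp_add)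
qed

lemma Theta_holomorphic: "Theta holomorphic_on S"
proof -
  have "(\<lambda>z. \<Sum>\<^sub>\<infinity>n. theta_term n z) holomorphic_on UNIV"
  proof (rule holomorphic_on_infsum)
    show "theta_term n holomorphic_on UNIV" for n
      unfolding theta_term_def by (intro holomorphic_intros)
    fix z :: complex
    have "norm w \<le> norm z + 1" if "w \<in> cball z 1" for w
      using that norm_triangle_ineq2[of w z] by (simp add: dist_norm norm_minus_commute)
    then have "\<forall>n\<in>UNIV. \<forall>w\<in>cball z 1. norm (theta_term n w) \<le> exp ((2 * pi * (norm z + 1) + 1)\<^sup>2) * exp (- 1 * \<bar>real_of_int n\<bar>)"
      using norm_theta_term_le by blast
    moreover have "(\<lambda>n. exp ((2 * pi * (norm z + 1) + 1)\<^sup>2) * exp (- 1 * \<bar>real_of_int n\<bar>)) summable_on UNIV"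
      by (intro summable_on_cmult_right exp_abs_int_summable_on) simp
    ultimately show "\<exists>r>0. \<exists>M. M summable_on UNIV \<and> (\<forall>n\<in>UNIV. \<forall>w\<in>cball z r. norm (theta_term n w) \<le> M n)"
      by (intro exI[of _ 1] conjI exI) auto
  qed auto
  then show ?thesis
    unfolding Theta_eq_infsum[abs_def, symmetric] by (rule holomorphic_on_subset) simp
qed

lemma Theta_plus_1: "Theta (z + 1) = Theta z"
proof -
  have "theta_term n (z + 1) = theta_term n z" for n
  proof -
    have "2 * of_real pi * \<i> * of_int n * (z + 1) - of_real pi * (of_int n)\<^sup>2
      = (2 * of_real pi * \<i> * of_int n * z - of_real pi * (of_int n)\<^sup>2) + 2 * of_int n * of_real pi * \<i>"
      by (simp add: algebra_simps)
    moreover have "exp (2 * of_int n * of_real pi * \<i>) = 1"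
      using exp_2pi_1_int[of n] by (simp add: mult_ac)
    ultimately show ?thesis unfolding theta_term_def by (simp only: exp_add mult_1_right)
  qed
  then show ?thesis by (simp add: Theta_eq_infsum)
qed

lemma Theta_plus_i: "Theta (z + \<i>) = - exp (of_real pi - 2 * of_real pi * \<i> * z) * Theta z"
proof -
  have b: "bij_betw (\<lambda>n::int. n + 1) UNIV UNIV"
    by (rule bij_betwI[of _ _ _ "\<lambda>n. n - 1"]) auto
  have "theta_term n (z + \<i>) = - exp (of_real pi - 2 * of_real pi * \<i> * z) * theta_term (n + 1) z" for n
  proof -
    have "2 * of_real pi * \<i> * of_int n * (z + \<i>) - of_real pi * (of_int n)\<^sup>2 =
      (of_real pi - 2 * of_real pi * \<i> * z) + (2 * of_real pi * \<i> * of_int (n + 1) * z - of_real pi * (of_int (n + 1))\<^sup>2)"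
      by (simp add: algebra_simps power2_eq_square)
    then show ?thesis unfolding theta_term_def by (simp add: exp_add power_int_add)
  qed
  then have "Theta (z + \<i>) = (\<Sum>\<^sub>\<infinity>n. - exp (of_real pi - 2 * of_real pi * \<i> * z) * theta_term (n + 1) z)"
    by (simp only: Theta_eq_infsum)
  also have "\<dots> = - exp (of_real pi - 2 * of_real pi * \<i> * z) * (\<Sum>\<^sub>\<infinity>n. theta_term (n + 1) z)"
    by (rule infsum_cmult_right')
  also have "(\<Sum>\<^sub>\<infinity>n. theta_term (n + 1) z) = Theta z"
    unfolding Theta_eq_infsum by (rule infsum_reindex_bij_betw[OF b])
  finally show ?thesis .
qed

text \<open>At i/2 the exponent is - pi n (n + 1), invariant under n -> - n - 1, while the sign
  (-1)^n is reversed; the terms cancel in pairs.\<close>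

lemma Theta_half_i: "Theta (\<i> / 2) = 0"
proof -
  have b: "bij_betw (\<lambda>n::int. - n - 1) UNIV UNIV"
    by (rule bij_betwI[of _ _ _ "\<lambda>n. - n - 1"]) auto
  have "theta_term (- n - 1) (\<i> / 2) = - theta_term n (\<i> / 2)" for n
  proof -
    have "2 * of_real pi * \<i> * of_int (- n - 1) * (\<i> / 2) - of_real pi * (of_int (- n - 1))\<^sup>2
       = 2 * of_real pi * \<i> * of_int n * (\<i> / 2) - of_real pi * (of_int n :: complex)\<^sup>2"
      by (simp add: algebra_simps power2_eq_square)
    moreover have "(-1::complex) powi (- n - 1) = - ((-1) powi n)"
      by (simp add: power_int_diff power_int_minus flip: power_int_inverse)
    ultimately show ?thesis unfolding theta_term_def by simp
  qed
  then have "Theta (\<i> / 2) = - Theta (\<i> / 2)"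
    unfolding Theta_eq_infsum infsum_uminus[symmetric]
    using infsum_reindex_bij_betw[OF b, of "\<lambda>n. theta_term n (\<i> / 2)"] by simp
  then show ?thesis by simp
qed

text \<open>Completing the square, n^2 + n = (n + 1/2)^2 - 1/4; this is the source of pi / 4 here
  and in the derivative below.\<close>

lemma Theta_shift_half_i:
  "Theta (\<i> / 2 + w) = \<i> * exp (of_real (pi / 4) - \<i> * of_real pi * w) * theta1 (of_real pi * w) (exp (- pi))"
proof -
  have "theta_term n (\<i> / 2 + w) = exp (of_real (pi / 4) - \<i> * of_real pi * w) *
    ((-1) powi n * of_real (exp (- pi) powr ((of_int n + 1/2)\<^sup>2)) * exp ((2 * of_int n + 1) * \<i> * (of_real pi * w)))" for n
  proof -
    have "2 * of_real pi * \<i> * of_int n * (\<i> / 2 + w) - of_real pi * (of_int n)\<^sup>2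
       = (of_real (pi / 4) - \<i> * of_real pi * w) + (of_real (- pi * (of_int n + 1/2)\<^sup>2) + (2 * of_int n + 1) * \<i> * (of_real pi * w))"
      by (simp add: algebra_simps power2_eq_square)
    then show ?thesis unfolding theta_term_def exp_minus_pi_powr by (simp only: exp_add mult_ac)
  qed
  then show ?thesis
    unfolding Theta_eq_infsum theta1_def by (simp only: infsum_cmult_right') (simp add: algebra_simps)
qed

text \<open>The half-period relation is solved for \<open>theta1\<close>, so that differentiability
  comes from the holomorphic \<open>Theta\<close>. As \<open>Theta\<close> vanishes at i/2, the
  derivative of the exponential factor contributes nothing.\<close>

lemma Theta_has_derivative_half_i:
  "(Theta has_field_derivative \<i> * of_real pi * exp (of_real (pi / 4)) * theta1' 0 (exp (- pi))) (at (\<i> / 2))"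
proof -
  have th1: "theta1 z (exp (- pi)) = - \<i> * exp (\<i> * z - of_real (pi / 4)) * Theta (\<i> / 2 + z / of_real pi)" for z
    by (simp add: Theta_shift_half_i exp_diff exp_minus)
  have "Theta holomorphic_on UNIV" by (rule Theta_holomorphic)
  then have D: "(Theta has_field_derivative deriv Theta (\<i> / 2)) (at (\<i> / 2))"
    by (simp add: holomorphic_derivI)
  have D2: "((\<lambda>z. Theta (\<i> / 2 + z / of_real pi)) has_field_derivative deriv Theta (\<i> / 2) * (1 / of_real pi)) (at 0)"
    by (rule DERIV_chain2[where g = "\<lambda>z. \<i> / 2 + z / of_real pi"]) (use D in \<open>auto intro!: derivative_eq_intros\<close>)
  have "((\<lambda>z. - \<i> * exp (\<i> * z - of_real (pi / 4)) * Theta (\<i> / 2 + z / of_real pi)) has_field_derivative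
      - \<i> * exp (- of_real (pi / 4)) * (deriv Theta (\<i> / 2) / of_real pi)) (at 0)"
    by (rule derivative_eq_intros D2 refl | simp add: Theta_half_i)+
  then have "theta1' 0 (exp (- pi)) = - \<i> * exp (- of_real (pi / 4)) * (deriv Theta (\<i> / 2) / of_real pi)"
    unfolding theta1'_def th1 by (rule DERIV_imp_deriv)
  then have "deriv Theta (\<i> / 2) = \<i> * of_real pi * exp (of_real (pi / 4)) * theta1' 0 (exp (- pi))"
    by (simp add: exp_minus field_simps)
  with D show ?thesis by simp
qed

section \<open>The doubly periodic product\<close>

definition sech_square_sum :: "complex \<Rightarrow> complex" where
  "sech_square_sum t = (\<Sum>\<^sub>\<infinity>l. chi t l * (sech_term t l)\<^sup>2)"

text \<open>For l nonzero, the real part of l - t stays at distance at least 1 -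
  \<open>\<rho>\<close> from 0, hence away from the zeros of cosh. The bound is uniform over the
  closed substrip, ready for the Weierstrass test.\<close>

lemma norm_sech_square_term_le:
  assumes "\<bar>Re t\<bar> \<le> \<rho>" "\<rho> < 1" "l \<noteq> 0"
  shows "norm (chi t l * (sech_term t l)\<^sup>2)
       \<le> (2 / (1 - exp (- 2 * pi * (1 - \<rho>))))\<^sup>2 * exp (2 * pi * \<rho>) * exp (- (2 * pi * (1 - \<rho>)) * \<bar>real_of_int l\<bar>)"
proof -
  define K where "K = 2 / (1 - exp (- 2 * pi * (1 - \<rho>)))"
  define m where "m = \<bar>real_of_int l\<bar>"
  have K: "K > 0" using assms by (simp add: K_def)
  have m1: "m \<ge> 1" using assms by (simp add: m_def)
  have x: "\<bar>Re (of_int l - t)\<bar> \<ge> m - \<rho>" using assms by (simp add: m_def)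
  then have "norm (sech_term t l) \<le> K * exp (- pi * \<bar>Re (of_int l - t)\<bar>)"
    unfolding sech_term_def K_def using m1 assms by (intro norm_inverse_cosh_le) auto
  also have "\<dots> \<le> K * exp (- pi * (m - \<rho>))"
    using x K by (intro mult_left_mono) auto
  finally have s: "norm (sech_term t l) \<le> K * exp (- pi * (m - \<rho>))" .
  have "- (of_int l * Re t) \<le> m * \<rho>"
  proof -
    have "\<bar>of_int l * Re t\<bar> \<le> m * \<rho>"
      unfolding abs_mult m_def using assms by (intro mult_left_mono) auto
    then show ?thesis by linarith
  qed
  then have "2 * pi * (- (of_int l * Re t)) \<le> 2 * pi * (m * \<rho>)" by (intro mult_left_mono) auto
  then have c: "norm (chi t l) \<le> exp (2 * pi * m * \<rho>)" by (simp add: norm_chi mult_ac)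
  have "norm (chi t l * (sech_term t l)\<^sup>2) \<le> exp (2 * pi * m * \<rho>) * (K * exp (- pi * (m - \<rho>)))\<^sup>2"
    unfolding norm_mult norm_power by (intro mult_mono c power_mono s) auto
  also have "\<dots> = K\<^sup>2 * (exp (2 * pi * m * \<rho>) * (exp (- pi * (m - \<rho>)))\<^sup>2)"
    by (simp add: power_mult_distrib)
  also have "exp (2 * pi * m * \<rho>) * (exp (- pi * (m - \<rho>)))\<^sup>2 = exp (2 * pi * \<rho>) * exp (- (2 * pi * (1 - \<rho>)) * m)"
    by (simp add: algebra_simps flip: exp_add exp_double)
  finally show ?thesis by (simp add: K_def m_def mult.assoc)
qed

text \<open>The term l = 0, the only one with poles in the strip, is split off. At a pole it counts
  as 0 by the convention for division, which does not affect summability.\<close>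

lemma sech_square_summable:
  assumes "\<bar>Re t\<bar> < 1"
  shows "((\<lambda>l. chi t l * (sech_term t l)\<^sup>2) has_sum sech_square_sum t) UNIV"
    and "sech_square_sum t = (1 / cosh (of_real pi * t))\<^sup>2 + (\<Sum>\<^sub>\<infinity>l\<in>- {0}. chi t l * (sech_term t l)\<^sup>2)"
proof -
  let ?f = "\<lambda>l. chi t l * (sech_term t l)\<^sup>2"
  let ?C = "(2 / (1 - exp (- 2 * pi * (1 - \<bar>Re t\<bar>))))\<^sup>2 * exp (2 * pi * \<bar>Re t\<bar>)"
  have "2 * pi * (1 - \<bar>Re t\<bar>) > 0" using assms by simp
  from summable_on_cmult_right[OF exp_abs_int_summable_on[OF this], of ?C]
  have "(\<lambda>l. ?C * exp (- (2 * pi * (1 - \<bar>Re t\<bar>)) * \<bar>real_of_int l\<bar>)) summable_on - {0}"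
    by (rule summable_on_subset_banach) simp
  then have "(?f has_sum infsum ?f (- {0})) (- {0})"
    by (rule abs_summable_on_imp_has_sum) (use norm_sech_square_term_le[of t "\<bar>Re t\<bar>"] assms in auto)
  then have "(?f has_sum (?f 0 + infsum ?f (- {0}))) (insert 0 (- {0}))"
    by (intro has_sum_insert) auto
  moreover have "insert 0 (- {0}) = (UNIV :: int set)" by auto
  moreover have "?f 0 = (1 / cosh (of_real pi * t))\<^sup>2" by (simp add: sech_term_def)
  ultimately have *: "(?f has_sum ((1 / cosh (of_real pi * t))\<^sup>2 + infsum ?f (- {0}))) UNIV" by metis
  then show "sech_square_sum t = (1 / cosh (of_real pi * t))\<^sup>2 + infsum ?f (- {0})"
    unfolding sech_square_sum_def by (rule infsumI)
  with * show "(?f has_sum sech_square_sum t) UNIV" by simp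
qed

text \<open>The zeros of cosh (pi z) are the points i (n + 1/2); the open band contains just one of
  them.\<close>

lemma cosh_pi_neq_0:
  assumes "- 1 / 2 < Im z" "Im z < 3 / 2" "z \<noteq> \<i> / 2"
  shows "cosh (of_real pi * z) \<noteq> 0"
proof
  assume "cosh (of_real pi * z) = 0"
  then have "1 + exp (2 * of_real pi * z) = 0" by (simp add: cosh_conv_exp)
  then have "exp (2 * of_real pi * z) = exp (of_real pi * \<i>)"
    by (simp add: add_eq_0_iff)
  then obtain n :: int where n: "2 * of_real pi * z = of_real pi * \<i> + (of_int (2 * n) * pi) * \<i>"
    unfolding exp_eq by blast
  then have "of_real pi * (2 * z) = of_real pi * (\<i> + 2 * of_int n * \<i>)"
    by (simp add: algebra_simps)
  then have z: "2 * z = \<i> + 2 * of_int n * \<i>" by (subst (asm) mult_cancel_left) simp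
  have "2 * Im z = 1 + 2 * of_int n" using arg_cong[OF z, of Im] by simp
  with assms have "n = 0" by linarith
  with z have "z = \<i> / 2" by (simp add: mult.commute)
  with assms show False by simp
qed

lemma holomorphic_on_sech_square_tail:
  "(\<lambda>t. \<Sum>\<^sub>\<infinity>l\<in>- {0}. chi t l * (sech_term t l)\<^sup>2) holomorphic_on {t. \<bar>Re t\<bar> < 1}"
proof (rule holomorphic_on_infsum)
  have "{t. \<bar>Re t\<bar> < 1} = {t. - 1 < Re t} \<inter> {t. Re t < 1}" by auto
  then show "open {t. \<bar>Re t\<bar> < 1}"
    by (simp add: open_Int open_halfspace_Re_gt open_halfspace_Re_lt)
  fix l :: int assume l: "l \<in> - {0}"
  have "cosh (of_real pi * (of_int l - t)) \<noteq> 0" if "\<bar>Re t\<bar> < 1" for t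
  proof -
    have "\<bar>real_of_int l\<bar> \<ge> 1" using l by simp
    with that have "Re (of_int l - t) \<noteq> 0" by auto
    from one_plus_exp_neq_0[OF this] show ?thesis by (simp add: cosh_conv_exp)
  qed
  then show "(\<lambda>t. chi t l * (sech_term t l)\<^sup>2) holomorphic_on {t. \<bar>Re t\<bar> < 1}"
    unfolding chi_def sech_term_def cosh_field_def
    by (intro holomorphic_intros) auto
next
  fix z :: complex assume z: "z \<in> {t. \<bar>Re t\<bar> < 1}"
  define r where "r = (1 - \<bar>Re z\<bar>) / 2"
  have r: "r > 0" "\<bar>Re z\<bar> + r < 1" using z by (auto simp: r_def field_simps)
  define \<rho> where "\<rho> = \<bar>Re z\<bar> + r"
  define M where "M = (\<lambda>l. (2 / (1 - exp (- 2 * pi * (1 - \<rho>))))\<^sup>2 * exp (2 * pi * \<rho>) * exp (- (2 * pi * (1 - \<rho>)) * \<bar>real_of_int l\<bar>))"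
  have "2 * pi * (1 - \<rho>) > 0" using r by (simp add: \<rho>_def)
  then have "M summable_on UNIV"
    unfolding M_def by (intro summable_on_cmult_right exp_abs_int_summable_on)
  then have "M summable_on - {0}" by (rule summable_on_subset_banach) simp
  moreover have "norm (chi w l * (sech_term w l)\<^sup>2) \<le> M l" if "l \<in> - {0}" "w \<in> cball z r" for l w
  proof -
    have "\<bar>Re (w - z)\<bar> \<le> r" using that abs_Re_le_cmod[of "w - z"] by (simp add: dist_norm norm_minus_commute)
    then have "\<bar>Re w\<bar> \<le> \<rho>" by (simp add: \<rho>_def)
    then show ?thesis unfolding M_def using that r by (intro norm_sech_square_term_le) (auto simp: \<rho>_def)
  qed
  ultimately show "\<exists>r>0. \<exists>M. M summable_on - {0} \<and> (\<forall>l\<in>- {0}. \<forall>w\<in>cball z r. norm (chi w l * (sech_term w l)\<^sup>2) \<le> M l)"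
    using r by blast
qed

text \<open>The two series do not agree term by term. After an index shift the terms differ by - 4
  \<open>chi t l * fermi (of_int l - t)\<close>, because sech^2 (pi u) (1 + exp (- 2 pi u)) = 4
  \<open>fermi u\<close>, and these differences sum to 0 in the strip where t and t + 1 are both
  admissible.\<close>

lemma sech_square_sum_plus_1:
  assumes "- 1 < Re t" "Re t < 0"
  shows "exp (4 * of_real pi * t + 2 * of_real pi) * sech_square_sum (t + 1) = sech_square_sum t"
proof -
  let ?E = "exp (4 * of_real pi * t + 2 * of_real pi)"
  have b: "bij_betw (\<lambda>n::int. n + 1) UNIV UNIV"
    by (rule bij_betwI[of _ _ _ "\<lambda>n. n - 1"]) auto
  have s1: "((\<lambda>l. chi t l * (sech_term t l)\<^sup>2) has_sum sech_square_sum t) UNIV"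
    using assms by (intro sech_square_summable) auto
  have "((\<lambda>l. chi (t + 1) l * (sech_term (t + 1) l)\<^sup>2) has_sum sech_square_sum (t + 1)) UNIV"
    using assms by (intro sech_square_summable) auto
  then have "((\<lambda>l. chi (t + 1) (l + 1) * (sech_term (t + 1) (l + 1))\<^sup>2) has_sum sech_square_sum (t + 1)) UNIV"
    by (subst (asm) has_sum_reindex_bij_betw[OF b, symmetric])
  from has_sum_diff[OF has_sum_cmult_right[OF this, of ?E] s1]
  have d: "((\<lambda>l. ?E * (chi (t + 1) (l + 1) * (sech_term (t + 1) (l + 1))\<^sup>2) - chi t l * (sech_term t l)\<^sup>2)
     has_sum (?E * sech_square_sum (t + 1) - sech_square_sum t)) UNIV" .
  have "?E * (chi (t + 1) (l + 1) * (sech_term (t + 1) (l + 1))\<^sup>2) - chi t l * (sech_term t l)\<^sup>2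
      = - 4 * (chi t l * fermi (of_int l - t))" for l
  proof -
    define u where "u = of_int l - t"
    have "Re u \<noteq> 0"
    proof
      assume "Re u = 0"
      then have "Re t = of_int l" by (simp add: u_def)
      with assms have "-1 < l" "l < 0" by linarith+
      then show False by simp
    qed
    then have nz: "1 + exp (2 * of_real pi * u) \<noteq> 0" by (rule one_plus_exp_neq_0)
    have "?E * exp (- 2 * of_real pi * of_int (l + 1) * (t + 1)) = exp (- 2 * of_real pi * of_int l * t) * exp (- 2 * of_real pi * u)"
      unfolding exp_add[symmetric] by (rule arg_cong[where f = exp]) (simp add: u_def algebra_simps)
    then have F1: "?E * chi (t + 1) (l + 1) = - (chi t l * exp (- 2 * of_real pi * u))"
      by (simp add: chi_def power_int_add mult_ac)
    have F2: "sech_term (t + 1) (l + 1) = sech_term t l" by (simp add: sech_term_def)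
    have F3: "(sech_term t l)\<^sup>2 * (1 + exp (- 2 * of_real pi * u)) = 4 * fermi u"
    proof -
      define E where "E = exp (of_real pi * u)"
      have E: "E \<noteq> 0" "exp (2 * of_real pi * u) = E\<^sup>2" by (auto simp: E_def mult_ac simp flip: exp_double)
      have A: "exp (- 2 * of_real pi * u) = 1 / E\<^sup>2"
        using E(2) by (simp add: exp_minus field_simps)
      have B: "sech_term t l = 2 * E / (1 + E\<^sup>2)"
        unfolding sech_term_def u_def[symmetric] cosh_conv_exp E(2) by (simp add: E_def)
      have "1 + E\<^sup>2 \<noteq> 0" using nz E(2) by simp
      then show ?thesis
        unfolding A B fermi_def E(2) using E(1) by (simp add: divide_simps) (simp add: algebra_simps power2_eq_square)
    qed
    have "?E * (chi (t + 1) (l + 1) * (sech_term (t + 1) (l + 1))\<^sup>2) - chi t l * (sech_term t l)\<^sup>2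
        = - (chi t l * ((sech_term t l)\<^sup>2 * (1 + exp (- 2 * of_real pi * u))))"
      unfolding F2 mult.assoc[symmetric] F1 by (simp add: algebra_simps)
    then show ?thesis unfolding F3 u_def[symmetric] by simp
  qed
  with d have "((\<lambda>l. - 4 * (chi t l * fermi (of_int l - t))) has_sum (?E * sech_square_sum (t + 1) - sech_square_sum t)) UNIV"
    by simp
  from has_sum_unique[OF this has_sum_cmult_right[OF chi_fermi_has_sum_0[OF assms], of "- 4"]]
  show ?thesis by simp
qed

lemma sech_square_sum_plus_i: "sech_square_sum (t + \<i>) = sech_square_sum t"
proof -
  have "chi (t + \<i>) l * (sech_term (t + \<i>) l)\<^sup>2 = chi t l * (sech_term t l)\<^sup>2" for l
  proof -
    have "exp (- 2 * of_real pi * of_int l * (t + \<i>)) = exp (- 2 * of_real pi * of_int l * t + \<i> * (of_int (- l) * (of_real pi * 2)))"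
      by (rule arg_cong[where f = exp]) (simp add: algebra_simps)
    also have "\<dots> = exp (- 2 * of_real pi * of_int l * t)" by (rule exp_plus_2pin)
    finally have "chi (t + \<i>) l = chi t l" by (simp only: chi_def)
    moreover have "sech_term (t + \<i>) l = - sech_term t l"
    proof -
      have "exp (of_real pi * (of_int l - (t + \<i>))) = - exp (of_real pi * (of_int l - t))"
        using exp_diff[of "of_real pi * (of_int l - t)" "of_real pi * \<i>"] by (simp add: algebra_simps)
      moreover have "exp (- (of_real pi * (of_int l - (t + \<i>)))) = - exp (- (of_real pi * (of_int l - t)))"
        using exp_add[of "- (of_real pi * (of_int l - t))" "of_real pi * \<i>"] by (simp add: algebra_simps)
      ultimately have "cosh (of_real pi * (of_int l - (t + \<i>))) = - cosh (of_real pi * (of_int l - t))"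
        by (simp add: cosh_field_def field_simps)
      then show ?thesis by (simp add: sech_term_def)
    qed
    ultimately show ?thesis by simp
  qed
  then show ?thesis by (simp add: sech_square_sum_def)
qed

section \<open>Quasi-periodicity factors and constancy of the product\<close>

lemma exp_Theta_square_plus_1:
  "exp (2 * of_real pi * (t + 1)\<^sup>2) * (Theta (t + 1))\<^sup>2
    = exp (4 * of_real pi * t + 2 * of_real pi) * (exp (2 * of_real pi * t\<^sup>2) * (Theta t)\<^sup>2)"
proof -
  have "2 * of_real pi * (t + 1)\<^sup>2 = (4 * of_real pi * t + 2 * of_real pi) + 2 * of_real pi * t\<^sup>2"
    by (simp add: algebra_simps power2_eq_square)
  then show ?thesis by (simp only: exp_add Theta_plus_1 mult.assoc)
qed

text \<open>This fixes the Gaussian: the shift by i multiplies it by exp (4 pi i t - 2 pi), the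
  inverse of the factor picked up by the square of \<open>Theta\<close>.\<close>

lemma exp_Theta_square_plus_i:
  "exp (2 * of_real pi * (t + \<i>)\<^sup>2) * (Theta (t + \<i>))\<^sup>2 = exp (2 * of_real pi * t\<^sup>2) * (Theta t)\<^sup>2"
proof -
  let ?E = "exp (of_real pi - 2 * of_real pi * \<i> * t)"
  have "2 * of_real pi * (t + \<i>)\<^sup>2 + ((of_real pi - 2 * of_real pi * \<i> * t) + (of_real pi - 2 * of_real pi * \<i> * t)) = 2 * of_real pi * t\<^sup>2"
    by (simp add: algebra_simps power2_eq_square)
  then have "exp (2 * of_real pi * (t + \<i>)\<^sup>2) * ?E\<^sup>2 = exp (2 * of_real pi * t\<^sup>2)"
    unfolding power2_eq_square exp_add[symmetric] by simp
  then show ?thesis unfolding Theta_plus_i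
    by (simp add: power_mult_distrib flip: mult.assoc)
qed

text \<open>The plain formula would give 0 at i/2, where \<open>Theta\<close> vanishes, so the limit
  is inserted there by hand.\<close>

definition theta_sech_product :: "complex \<Rightarrow> complex" where
  "theta_sech_product t = (if t = \<i> / 2 then (theta1' 0 (exp (- pi)))\<^sup>2
          else exp (2 * of_real pi * t\<^sup>2) * (Theta t)\<^sup>2 * sech_square_sum t)"

text \<open>It contains the closed unit cell in its interior, stays in the strip of convergence, and
  meets the poles of the sum only at i/2; the poles - i/2 and 3 i/2 lie on its boundary.\<close>

definition period_rect :: "complex set" where
  "period_rect = {t. \<bar>Re t\<bar> < 1 \<and> - 1 / 2 < Im t \<and> Im t < 3 / 2}"

lemma period_rect_eq_box: "period_rect = box (Complex (-1) (-1/2)) (Complex 1 (3/2))"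
  by (auto simp: period_rect_def in_box_complex_iff)

lemma open_period_rect: "open period_rect" and connected_period_rect: "connected period_rect"
  by (auto simp: period_rect_eq_box intro: convex_connected)

lemma theta_sech_product_plus_1:
  assumes "- 1 < Re t" "Re t < 0"
  shows "theta_sech_product (t + 1) = theta_sech_product t"
proof -
  have "t \<noteq> \<i> / 2" "t + 1 \<noteq> \<i> / 2" using assms by (auto simp: complex_eq_iff)
  then have "theta_sech_product (t + 1) = exp (2 * of_real pi * t\<^sup>2) * (Theta t)\<^sup>2 *
     (exp (4 * of_real pi * t + 2 * of_real pi) * sech_square_sum (t + 1))"
    by (simp add: theta_sech_product_def exp_Theta_square_plus_1)
  also have "\<dots> = theta_sech_product t"
    unfolding sech_square_sum_plus_1[OF assms] using \<open>t \<noteq> \<i> / 2\<close> by (simp add: theta_sech_product_def)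
  finally show ?thesis .
qed

lemma theta_sech_product_plus_i:
  assumes "t \<noteq> \<i> / 2" "t + \<i> \<noteq> \<i> / 2"
  shows "theta_sech_product (t + \<i>) = theta_sech_product t"
  using assms by (simp add: theta_sech_product_def exp_Theta_square_plus_i sech_square_sum_plus_i)

text \<open>Near i/2 the term l = 0 gives the square of \<open>Theta\<close> / cosh, which has a
  limit by l'Hopital's rule. The remaining series is holomorphic there and is multiplied by the
  vanishing square of \<open>Theta\<close>.\<close>

lemma theta_sech_product_tendsto: "(theta_sech_product \<longlongrightarrow> theta_sech_product (\<i> / 2)) (at (\<i> / 2))"
proof -
  let ?a = "\<i> / 2 :: complex" and ?th = "theta1' 0 (exp (- pi))"
  let ?B = "\<lambda>t. \<Sum>\<^sub>\<infinity>l\<in>- {0}. chi t l * (sech_term t l)\<^sup>2"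
  have e: "exp (of_real pi * ?a) = \<i>" "exp (- (of_real pi * ?a)) = - \<i>"
    by (auto simp: exp_eq_polar cis_conv_exp[symmetric] exp_minus field_simps cis.ctr complex_eq_iff)
  have q: "((\<lambda>t. Theta t / cosh (of_real pi * t)) \<longlongrightarrow> exp (of_real (pi / 4)) * ?th) (at ?a)"
  proof (rule lhopital_complex_simple)
    show "(Theta has_field_derivative \<i> * of_real pi * exp (of_real (pi / 4)) * ?th) (at ?a)"
      by (rule Theta_has_derivative_half_i)
    show "((\<lambda>t. cosh (of_real pi * t)) has_field_derivative of_real pi * \<i>) (at ?a)"
      by (rule derivative_eq_intros refl | use e in \<open>simp add: sinh_field_def\<close>)+
    show "cosh (of_real pi * ?a) = 0" using e by (simp add: cosh_field_def)
  qed (auto simp: Theta_half_i)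
  have holB: "?B holomorphic_on {t. \<bar>Re t\<bar> < 1}" by (rule holomorphic_on_sech_square_tail)
  have "{t. \<bar>Re t\<bar> < 1} = {t. - 1 < Re t} \<inter> {t. Re t < 1}" by auto
  then have op: "open {t. \<bar>Re t\<bar> < 1}"
    by (simp add: open_Int open_halfspace_Re_gt open_halfspace_Re_lt)
  have B: "(?B \<longlongrightarrow> ?B ?a) (at ?a)"
    using holomorphic_on_imp_continuous_on[OF holB] op
    by (simp add: continuous_on_eq_continuous_at isCont_def)
  have T: "(Theta \<longlongrightarrow> Theta ?a) (at ?a)"
    using holomorphic_on_imp_continuous_on[OF Theta_holomorphic[of UNIV]]
    by (simp add: continuous_on_eq_continuous_at isCont_def)
  have "((\<lambda>t. exp (2 * of_real pi * t\<^sup>2) * ((Theta t / cosh (of_real pi * t))\<^sup>2 + (Theta t)\<^sup>2 * ?B t))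
     \<longlongrightarrow> exp (2 * of_real pi * ?a\<^sup>2) * ((exp (of_real (pi / 4)) * ?th)\<^sup>2 + (Theta ?a)\<^sup>2 * ?B ?a)) (at ?a)"
    by (intro tendsto_intros q B T)
  also have "exp (2 * of_real pi * ?a\<^sup>2) * ((exp (of_real (pi / 4)) * ?th)\<^sup>2 + (Theta ?a)\<^sup>2 * ?B ?a) = ?th\<^sup>2"
  proof -
    \<comment> \<open>Since (i/2)^2 = - 1/4, the Gaussian equals exp (- pi / 2) and cancels the
      square of exp (pi / 4).\<close>
    have "exp (2 * of_real pi * ?a\<^sup>2) * (exp (of_real (pi / 4)))\<^sup>2 = (1 :: complex)"
      unfolding power2_eq_square exp_add[symmetric] by simp
    then show ?thesis by (simp add: Theta_half_i power_mult_distrib flip: mult.assoc)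
  qed
  also have "?th\<^sup>2 = theta_sech_product ?a" by (simp add: theta_sech_product_def)
  finally show ?thesis
  proof (rule Lim_transform_eventually)
    have "?a \<in> {t. \<bar>Re t\<bar> < 1}" by simp
    then have "\<forall>\<^sub>F t in at ?a. t \<in> {t. \<bar>Re t\<bar> < 1}"
      using op by (intro eventually_at_in_open') auto
    then show "\<forall>\<^sub>F t in at ?a. exp (2 * of_real pi * t\<^sup>2) * ((Theta t / cosh (of_real pi * t))\<^sup>2 + (Theta t)\<^sup>2 * ?B t) = theta_sech_product t"
      using eventually_neq_at_within[of ?a ?a UNIV]
    proof eventually_elim
      case (elim t)
      then have "sech_square_sum t = (1 / cosh (of_real pi * t))\<^sup>2 + ?B t"
        by (intro sech_square_summable(2)) simp
      with elim show ?case
        by (simp add: theta_sech_product_def algebra_simps power_divide)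
    qed
  qed
qed

lemma theta_sech_product_holomorphic: "theta_sech_product holomorphic_on period_rect"
proof (rule no_isolated_singularity'[where K = "{\<i> / 2}"])
  show "(theta_sech_product \<longlongrightarrow> theta_sech_product z) (at z within period_rect)" if "z \<in> {\<i> / 2}" for z
    using Lim_at_imp_Lim_at_within[OF theta_sech_product_tendsto, of period_rect] that by (simp only: singleton_iff)
  have "(\<lambda>t. exp (2 * of_real pi * t\<^sup>2) * (Theta t)\<^sup>2 * ((1 / cosh (of_real pi * t))\<^sup>2 +
     (\<Sum>\<^sub>\<infinity>l\<in>- {0}. chi t l * (sech_term t l)\<^sup>2))) holomorphic_on (period_rect - {\<i> / 2})"
  proof (intro holomorphic_intros Theta_holomorphic)
    show "(\<lambda>t. \<Sum>\<^sub>\<infinity>l\<in>- {0}. chi t l * (sech_term t l)\<^sup>2) holomorphic_on (period_rect - {\<i> / 2})"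
      by (rule holomorphic_on_subset[OF holomorphic_on_sech_square_tail]) (auto simp: period_rect_def)
    show "(\<lambda>t. cosh (of_real pi * t)) holomorphic_on (period_rect - {\<i> / 2})"
      unfolding cosh_field_def by (intro holomorphic_intros) auto
    show "cosh (of_real pi * z) \<noteq> 0" if "z \<in> period_rect - {\<i> / 2}" for z
      using that by (intro cosh_pi_neq_0) (auto simp: period_rect_def)
  qed
  then show "theta_sech_product holomorphic_on (period_rect - {\<i> / 2})"
    by (rule holomorphic_transform) (auto simp: theta_sech_product_def period_rect_def sech_square_summable(2))
qed (auto simp: open_period_rect)

lemma theta_sech_product_representative:
  assumes "z \<in> period_rect"
  shows "\<exists>z'\<in>cbox (Complex (-1/2) 0) (Complex (1/2) 1). theta_sech_product z' = theta_sech_product z"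
proof -
  have "\<exists>z1. \<bar>Re z1\<bar> < 1 \<and> 0 \<le> Im z1 \<and> Im z1 \<le> 1 \<and> theta_sech_product z1 = theta_sech_product z"
  proof -
    consider "Im z < 0" | "0 \<le> Im z" "Im z \<le> 1" | "Im z > 1" by linarith
    then show ?thesis
    proof cases
      case 1
      \<comment> \<open>Strict inequalities keep Im z and Im z + 1 different from 1/2, so neither
        point is the patched one.\<close>
      then have "theta_sech_product (z + \<i>) = theta_sech_product z"
        using assms by (intro theta_sech_product_plus_i) (auto simp: period_rect_def complex_eq_iff)
      then show ?thesis using 1 assms by (intro exI[of _ "z + \<i>"]) (auto simp: period_rect_def)
    next
      case 3
      then have "theta_sech_product ((z - \<i>) + \<i>) = theta_sech_product (z - \<i>)"
        using assms by (intro theta_sech_product_plus_i) (auto simp: period_rect_def complex_eq_iff)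
      then show ?thesis using 3 assms by (intro exI[of _ "z - \<i>"]) (auto simp: period_rect_def)
    qed (use assms in \<open>auto simp: period_rect_def\<close>)
  qed
  then obtain z1 where z1: "\<bar>Re z1\<bar> < 1" "0 \<le> Im z1" "Im z1 \<le> 1" "theta_sech_product z1 = theta_sech_product z" by blast
  consider "Re z1 < - 1/2" | "- 1/2 \<le> Re z1" "Re z1 \<le> 1/2" | "Re z1 > 1/2" by linarith
  then show ?thesis
  proof cases
    case 1
    then have "theta_sech_product (z1 + 1) = theta_sech_product z1" using z1 by (intro theta_sech_product_plus_1) auto
    then show ?thesis using 1 z1 by (intro bexI[of _ "z1 + 1"]) (auto simp: in_cbox_complex_iff)
  next
    case 2
    then show ?thesis using z1 by (intro bexI[of _ z1]) (auto simp: in_cbox_complex_iff)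
  next
    case 3
    then have "theta_sech_product ((z1 - 1) + 1) = theta_sech_product (z1 - 1)" using z1 by (intro theta_sech_product_plus_1) auto
    then show ?thesis using 3 z1 by (intro bexI[of _ "z1 - 1"]) (auto simp: in_cbox_complex_iff)
  qed
qed

lemma theta_sech_product_constant:
  assumes "z \<in> period_rect"
  shows "theta_sech_product z = (theta1' 0 (exp (- pi)))\<^sup>2"
proof -
  let ?Q = "cbox (Complex (-1/2) 0) (Complex (1/2) 1)"
  have Q: "?Q \<subseteq> period_rect" by (auto simp: period_rect_def in_cbox_complex_iff)
  have "Complex 0 0 \<in> ?Q" by (simp add: in_cbox_complex_iff)
  then have ne: "?Q \<noteq> {}" by blast
  have "continuous_on ?Q (\<lambda>z. norm (theta_sech_product z))"
    by (intro continuous_on_norm holomorphic_on_imp_continuous_on holomorphic_on_subset[OF theta_sech_product_holomorphic Q])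
  then have "\<exists>x\<in>?Q. \<forall>y\<in>?Q. norm (theta_sech_product y) \<le> norm (theta_sech_product x)"
    by (rule continuous_attains_sup[OF compact_cbox ne])
  then obtain x where x: "x \<in> ?Q" "\<And>y. y \<in> ?Q \<Longrightarrow> norm (theta_sech_product y) \<le> norm (theta_sech_product x)" by blast
  have "theta_sech_product constant_on period_rect"
  proof (rule maximum_modulus_principle[OF theta_sech_product_holomorphic open_period_rect connected_period_rect open_period_rect])
    show "x \<in> period_rect" using x Q by blast
    show "norm (theta_sech_product z) \<le> norm (theta_sech_product x)" if "z \<in> period_rect" for z
      using theta_sech_product_representative[OF that] x(2) by metis
  qed auto
  moreover have "\<i> / 2 \<in> period_rect" by (simp add: period_rect_def)
  ultimately have "theta_sech_product z = theta_sech_product (\<i> / 2)" using assms unfolding constant_on_def by metis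
  then show ?thesis by (simp add: theta_sech_product_def)
qed

lemma Theta_square_mult_sech_square_sum:
  assumes "t \<in> \<real>" "\<bar>Re t\<bar> < 1"
  shows "exp (2 * of_real pi * t\<^sup>2) * (Theta t)\<^sup>2 * sech_square_sum t = (theta1' 0 (exp (- pi)))\<^sup>2"
proof -
  have "Im t = 0" using assms(1) by (simp add: complex_is_Real_iff)
  then have "t \<in> period_rect" using assms by (simp add: period_rect_def)
  moreover have "t \<noteq> \<i> / 2"
  proof
    assume "t = \<i> / 2"
    then have "Im t = Im (\<i> / 2)" by (rule arg_cong)
    with \<open>Im t = 0\<close> show False by simp
  qed
  ultimately have "t \<in> period_rect" "t \<noteq> \<i> / 2" by auto
  with theta_sech_product_constant[of t] show ?thesis by (simp add: theta_sech_product_def)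
qed

section \<open>Nonvanishing of the constant\<close>

lemma exp_minus_pi_less: "exp (- pi) < 1 / 3"
proof -
  have "exp pi > 3" using exp_ge_add_one_self[of pi] pi_gt3 by linarith
  then show ?thesis by (simp add: exp_minus field_simps)
qed

lemma Theta_0_neq_0: "Theta 0 \<noteq> 0"
  unfolding Theta_eq_infsum
\<comment> \<open>The criterion reads 3 exp (- pi) < 1.\<close>
proof (rule infsum_int_neq_0[where A = 1 and c = pi])
  fix n :: int
  have "\<bar>real_of_int n\<bar> \<le> (real_of_int n)\<^sup>2"
    using self_le_power[of "\<bar>n\<bar>" 2] by (cases "n = 0") (auto simp flip: of_int_power of_int_abs)
  then have "- (pi * (real_of_int n)\<^sup>2) \<le> - pi * \<bar>real_of_int n\<bar>" by simp
  then show "norm (theta_term n 0) \<le> 1 * exp (- pi * \<bar>real_of_int n\<bar>)"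
    by (simp add: theta_term_def norm_mult norm_power_int power2_eq_square)
qed (use exp_minus_pi_less in \<open>auto simp: theta_term_def\<close>)

lemma sech_square_sum_0_neq_0: "sech_square_sum 0 \<noteq> 0"
  unfolding sech_square_sum_def
\<comment> \<open>The criterion reads 9 exp (- 2 pi) < 1, the square of the same numerical bound;
  the 4 comes from squaring 1 / cosh x, which is at most 2 exp (- |x|).\<close>
proof (rule infsum_int_neq_0[where A = 4 and c = "2 * pi"])
  fix n :: int
  have "norm (sech_term 0 n) \<le> 2 * exp (- pi * \<bar>real_of_int n\<bar>)"
    using norm_sech_term_real_le[of 0 n] by simp
  then have "(norm (sech_term 0 n))\<^sup>2 \<le> (2 * exp (- pi * \<bar>real_of_int n\<bar>))\<^sup>2"
    by (intro power_mono) auto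
  also have "\<dots> = 4 * exp (- (2 * pi) * \<bar>real_of_int n\<bar>)"
    by (simp add: power_mult_distrib flip: exp_double)
  finally show "norm (chi 0 n * (sech_term 0 n)\<^sup>2) \<le> 4 * exp (- (2 * pi) * \<bar>real_of_int n\<bar>)"
    by (simp add: norm_mult norm_chi norm_power)
next
  have "exp (- pi) ^ 2 < (1 / 3) ^ 2" using exp_minus_pi_less by (intro power_strict_mono) auto
  then show "(2 * 4 + 1) * exp (- (2 * pi)) < 1" by (simp add: power2_eq_square flip: exp_double exp_add)
qed (auto simp: sech_term_def)

lemma theta1'_0_neq_0: "theta1' 0 (exp (- pi)) \<noteq> 0"
  using Theta_square_mult_sech_square_sum[of 0] Theta_0_neq_0 sech_square_sum_0_neq_0 by auto

lemma sech_square_sum_eq: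
  assumes "t \<in> \<real>" "\<bar>Re t\<bar> < 1"
  shows "1 / sech_square_sum t = exp (2 * of_real pi * t\<^sup>2) * (Theta t)\<^sup>2 / (theta1' 0 (exp (- pi)))\<^sup>2"
    and "sech_square_sum t \<noteq> 0"
proof -
  note * = Theta_square_mult_sech_square_sum[OF assms]
  show "sech_square_sum t \<noteq> 0" using * theta1'_0_neq_0 by auto
  with * theta1'_0_neq_0
  show "1 / sech_square_sum t = exp (2 * of_real pi * t\<^sup>2) * (Theta t)\<^sup>2 / (theta1' 0 (exp (- pi)))\<^sup>2"
    by (simp add: field_simps)
qed

section \<open>The Fourier series of the reciprocal Zak transform\<close>

lemma integral_exp_2pi_int:
  "integral {0..1} (\<lambda>\<nu>. exp (2 * of_real pi * \<i> * of_int k * of_real \<nu>)) = (if k = 0 then 1 else 0)"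
proof (cases "k = 0")
  case False
  let ?c = "2 * of_real pi * \<i> * of_int k :: complex"
  have c: "?c \<noteq> 0" using False by simp
  have "((\<lambda>\<nu>. exp (?c * of_real \<nu>)) has_integral (exp (?c * of_real 1) / ?c - exp (?c * of_real 0) / ?c)) {0..1}"
  proof (rule fundamental_theorem_of_calculus)
    fix x :: real assume "x \<in> {0..1}"
    have "((\<lambda>z. exp (?c * z) / ?c) has_field_derivative exp (?c * of_real x)) (at (of_real x))"
      using c by (auto intro!: derivative_eq_intros)
    from has_vector_derivative_real_field[OF this]
    show "((\<lambda>\<nu>. exp (?c * of_real \<nu>) / ?c) has_vector_derivative exp (?c * of_real x)) (at x within {0..1})"
      by (rule has_vector_derivative_at_within)
  qed simp
  moreover have "exp ?c = 1" using exp_2pi_1_int[of k] by (simp add: mult_ac)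
  ultimately show ?thesis using False by (simp add: integral_unique)
qed simp

text \<open>Absolute summability gives uniform convergence along the finite index sets, so limit and
  integral commute. By orthogonality of the exponentials only m = n remains.\<close>

lemma integral_fourier_series:
  fixes c :: "int \<Rightarrow> complex"
  assumes "(\<lambda>m. norm (c m)) summable_on UNIV"
  shows "integral {0..1} (\<lambda>\<nu>. (\<Sum>\<^sub>\<infinity>m. c m * exp (2 * of_real pi * \<i> * of_int (n - m) * of_real \<nu>))) = c n"
proof -
  let ?f = "\<lambda>m \<nu>. c m * exp (2 * of_real pi * \<i> * of_int (n - m) * of_real \<nu>)"
  have "uniform_limit {0..1} (\<lambda>Y \<nu>. \<Sum>m\<in>Y. ?f m \<nu>) (\<lambda>\<nu>. \<Sum>\<^sub>\<infinity>m. ?f m \<nu>) (finite_subsets_at_top UNIV)"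
    by (rule Weierstrass_m_test_general[OF _ assms]) (simp add: norm_mult)
  moreover have "continuous_on {0..1} (\<lambda>\<nu>. \<Sum>m\<in>Y. ?f m \<nu>)" for Y
    by (intro continuous_intros)
  ultimately obtain I J where I: "\<And>Y. ((\<lambda>\<nu>. \<Sum>m\<in>Y. ?f m \<nu>) has_integral I Y) {0..1}"
    and J: "((\<lambda>\<nu>. \<Sum>\<^sub>\<infinity>m. ?f m \<nu>) has_integral J) {0..1}" and lim: "(I \<longlongrightarrow> J) (finite_subsets_at_top UNIV)"
    by (rule uniform_limit_integral) auto
  have "I Y = (\<Sum>m\<in>Y. if m = n then c n else 0)" for Y
  proof -
    have "I Y = integral {0..1} (\<lambda>\<nu>. \<Sum>m\<in>Y. ?f m \<nu>)" by (rule integral_unique[OF I, symmetric])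
    also have "\<dots> = (\<Sum>m\<in>Y. integral {0..1} (?f m))"
    proof (cases "finite Y")
      case True
      then show ?thesis by (intro integral_sum integrable_continuous_real continuous_intros)
    qed simp
    also have "\<dots> = (\<Sum>m\<in>Y. if m = n then c n else 0)"
    proof (rule sum.cong[OF refl])
      show "integral {0..1} (?f m) = (if m = n then c n else 0)" for m
        using integral_exp_2pi_int[of "n - m"] by simp
    qed
    finally show ?thesis .
  qed
  \<comment> \<open>The integrals of the partial sums, as a function of the finite set, are again
    partial sums, so their limit can be read as \<open>has_sum\<close>.\<close>
  then have "I = sum (\<lambda>m. if m = n then c n else 0)" by (rule ext)
  with lim have "((\<lambda>m. if m = n then c n else 0) has_sum J) UNIV"
    by (simp only: has_sum_def)
  moreover have "((\<lambda>m. if m = n then c n else 0) has_sum c n) UNIV"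
    by (rule has_sum_finite_neutralI[of "{n}"]) auto
  ultimately have "J = c n" by (rule has_sum_unique)
  with J show ?thesis by (simp add: integral_unique)
qed

text \<open>A shift by n only reindexes the series and leaves a phase. The coefficients are real, so
  conjugation merely reverses the frequencies.\<close>

lemma cnj_zak_g21:
  fixes t \<nu> :: real and n :: int
  shows "cnj (zak g21 (t + of_int n) \<nu>) = of_real (sqrt (pi / 2)) * exp (- 2 * of_real pi * \<i> * of_int n * of_real \<nu>) *
     (\<Sum>\<^sub>\<infinity>l. sech_term t l * exp (- 2 * of_real pi * \<i> * of_int l * of_real \<nu>))"
proof -
  have b: "bij_betw (\<lambda>l::int. l + n) UNIV UNIV"
    by (rule bij_betwI[of _ _ _ "\<lambda>l. l - n"]) auto
  have c: "g21 (t + of_int n - of_int (l + n)) = of_real (sqrt (pi / 2)) * sech_term t l" for l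
  proof -
    have "sech_term t l = 1 / cosh (of_real (pi * (t - of_int l)))"
      unfolding sech_term_def by (subst cosh_minus[symmetric]) (simp add: algebra_simps)
    also have "\<dots> = of_real (1 / cosh (pi * (t - of_int l)))"
      by (simp add: cosh_field_def flip: exp_of_real)
    finally show ?thesis by (simp add: g21_def)
  qed
  have r: "cnj (sech_term t l) = sech_term t l" for l
    by (simp add: sech_term_def cosh_field_def exp_cnj)
  let ?g = "\<lambda>l. g21 (t + of_int n - of_int l) * exp (2 * of_real pi * \<i> * of_int l * of_real \<nu>)"
  have "zak g21 (t + of_int n) \<nu> = (\<Sum>\<^sub>\<infinity>l. ?g (l + n))"
    unfolding zak_def by (rule infsum_reindex_bij_betw[OF b, symmetric])
  then have "cnj (zak g21 (t + of_int n) \<nu>) = (\<Sum>\<^sub>\<infinity>l. cnj (?g (l + n)))"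
    by (simp only: infsum_cnj)
  also have "\<dots> = (\<Sum>\<^sub>\<infinity>l. of_real (sqrt (pi / 2)) * exp (- 2 * of_real pi * \<i> * of_int n * of_real \<nu>) *
     (sech_term t l * exp (- 2 * of_real pi * \<i> * of_int l * of_real \<nu>)))"
  proof (rule infsum_cong)
    fix l
    have "cnj (exp (2 * of_real pi * \<i> * of_int (l + n) * of_real \<nu>))
        = exp (- 2 * of_real pi * \<i> * of_int n * of_real \<nu>) * exp (- 2 * of_real pi * \<i> * of_int l * of_real \<nu>)"
      unfolding exp_cnj exp_add[symmetric] by (rule arg_cong[where f = exp]) (simp add: algebra_simps)
    then show "cnj (?g (l + n)) = of_real (sqrt (pi / 2)) * exp (- 2 * of_real pi * \<i> * of_int n * of_real \<nu>) *
     (sech_term t l * exp (- 2 * of_real pi * \<i> * of_int l * of_real \<nu>))"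
      unfolding c complex_cnj_mult r by (simp only: complex_cnj_complex_of_real mult_ac)
  qed
  finally show ?thesis by (simp only: infsum_cmult_right')
qed

lemma inverse_cnj_zak_g21:
  fixes t \<nu> :: real and n :: int
  assumes "\<bar>t\<bar> < 1 / 2"
  shows "1 / cnj (zak g21 (t + of_int n) \<nu>) =
    (\<Sum>\<^sub>\<infinity>m. (1 / (of_real (sqrt (pi / 2)) * sech_square_sum t) * dual_term t m)
         * exp (2 * of_real pi * \<i> * of_int (n - m) * of_real \<nu>))"
proof -
  define e where "e = (\<lambda>l::int. exp (- 2 * of_real pi * \<i> * of_int l * of_real \<nu>))"
  define F H where "F = (\<Sum>\<^sub>\<infinity>l. sech_term t l * e l)" and "H = (\<Sum>\<^sub>\<infinity>m. dual_term t m * e m)"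
  have S: "sech_square_sum t \<noteq> 0" using assms by (intro sech_square_sum_eq) auto
  have FH: "F * H = sech_square_sum t"
    unfolding F_def H_def sech_square_sum_def
  proof (rule sech_dual_convolution)
    show "e (k + l) = e k * e l" for k l
      unfolding e_def exp_add[symmetric] by (rule arg_cong[where f = exp]) (simp add: algebra_simps)
  qed (use assms in \<open>auto simp: e_def\<close>)
  have en: "exp (2 * of_real pi * \<i> * of_int (n - m) * of_real \<nu>) = 1 / e n * e m" for m
  proof -
    have "1 / e n = exp (2 * of_real pi * \<i> * of_int n * of_real \<nu>)"
      by (simp add: e_def exp_minus divide_inverse)
    then show ?thesis
      unfolding e_def by (simp only: exp_add[symmetric]) (rule arg_cong[where f = exp], simp add: algebra_simps)
  qed
  have Z: "cnj (zak g21 (t + of_int n) \<nu>) = of_real (sqrt (pi / 2)) * e n * F"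
    unfolding cnj_zak_g21 e_def F_def ..
  \<comment> \<open>Up to a nonzero factor, \<open>F\<close> is the conjugate Zak transform; its
    zero-freeness follows from \<open>F * H\<close> being nonzero.\<close>
  have "F \<noteq> 0" using FH S by auto
  then have "1 / F = H / sech_square_sum t" using FH S by (simp add: field_simps)
  moreover have "1 / cnj (zak g21 (t + of_int n) \<nu>) = 1 / of_real (sqrt (pi / 2)) * (1 / e n) * (1 / F)"
    by (simp add: Z)
  ultimately have "1 / cnj (zak g21 (t + of_int n) \<nu>) = 1 / (of_real (sqrt (pi / 2)) * sech_square_sum t) * (1 / e n) * H"
    by simp
  also have "\<dots> = (\<Sum>\<^sub>\<infinity>m. 1 / (of_real (sqrt (pi / 2)) * sech_square_sum t) * (1 / e n) * (dual_term t m * e m))"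
    unfolding H_def by (rule infsum_cmult_right'[symmetric])
  also have "\<dots> = (\<Sum>\<^sub>\<infinity>m. (1 / (of_real (sqrt (pi / 2)) * sech_square_sum t) * dual_term t m)
         * exp (2 * of_real pi * \<i> * of_int (n - m) * of_real \<nu>))"
    unfolding en by (intro infsum_cong) (simp add: mult_ac)
  finally show ?thesis .
qed

theorem mainTheorem4:
  fixes t :: real and n :: int
  assumes "t \<in> {-1/2<..<1/2}"
  shows "g21_dual (t + of_int n) =
    of_real (sqrt 2) * (-1) powi n * (theta4 (of_real (pi * t)) (exp (- pi)))\<^sup>2
      * of_real (exp (2 * pi * t\<^sup>2 + 2 * pi * of_int n * t))
    / (of_real (sqrt pi) * (theta1' 0 (exp (- pi)))\<^sup>2 * of_real (cosh (pi * (t + of_int n))))"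
proof -
  have t: "\<bar>t\<bar> < 1 / 2" using assms by auto
  then have c: "pi * (1 - 2 * \<bar>t\<bar>) > 0" by simp
  let ?K = "1 / (of_real (sqrt (pi / 2)) * sech_square_sum t)"
  have "(\<lambda>m. norm ?K * (2 * exp (pi * \<bar>t\<bar>) * exp (- (pi * (1 - 2 * \<bar>t\<bar>)) * \<bar>real_of_int m\<bar>))) summable_on UNIV"
    by (intro summable_on_cmult_right exp_abs_int_summable_on c)
  then have summ: "(\<lambda>m. norm (?K * dual_term t m)) summable_on UNIV"
  proof (rule Infinite_Sum.abs_summable_on_comparison_test')
    show "norm (?K * dual_term t m) \<le> norm ?K * (2 * exp (pi * \<bar>t\<bar>) * exp (- (pi * (1 - 2 * \<bar>t\<bar>)) * \<bar>real_of_int m\<bar>))" for m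
      unfolding norm_mult[of ?K] using norm_dual_term_le[of t m] by (intro mult_left_mono) auto
  qed
  have "g21_dual (t + of_int n) = ?K * dual_term t n"
    unfolding g21_dual_def inverse_cnj_zak_g21[OF t] by (rule integral_fourier_series[OF summ])
  also have "dual_term t n = (-1) powi n * of_real (exp (2 * pi * of_int n * t)) / of_real (cosh (pi * (t + of_int n)))"
  proof -
    have "cosh (of_real pi * (of_int n - - complex_of_real t)) = of_real (cosh (pi * (t + of_int n)))"
      by (simp add: cosh_field_def add.commute flip: exp_of_real)
    then show ?thesis
      by (simp add: dual_term_def chi_def sech_term_def flip: exp_of_real)
  qed
  also have "?K = of_real (sqrt 2 / sqrt pi) * (1 / sech_square_sum t)"
    by (simp add: real_sqrt_divide)
  also have "1 / sech_square_sum t = of_real (exp (2 * pi * t\<^sup>2)) * (theta4 (of_real (pi * t)) (exp (- pi)))\<^sup>2 / (theta1' 0 (exp (- pi)))\<^sup>2"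
    using sech_square_sum_eq(1)[of t] t by (simp add: Theta_def flip: exp_of_real)
  finally show ?thesis
    by (simp add: exp_add mult_ac)
qed

end
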